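(* The only solutions of the equation $1+x^2=2y^4$ in positive integers $(x,y)$ are $(x,y)=(1,1)$ and $(x,y)=(239,13)$. *)

theory Defs
  imports Main
begin

end

theory Submission
  imports Defs "HOL-Analysis.Analysis" "HOL-Number_Theory.Cong" "HOL-Computational_Algebra.Nth_Powers"
begin

text \<open>
  The proof is the hypergeometric method of Thue and Siegel, started from the large solution
  \<open>1 + 239\<^sup>2 = 2 * 13 ^ 4\<close>.

  Factoring \<open>1 + x\<^sup>2 = 2 * y ^ 4\<close> over the Gaussian integers shows that \<open>x + \<sigma> \<i>\<close>, for a suitable
  sign \<open>\<sigma>\<close>, is \<open>\<plusminus> (1 + \<i>) * \<beta> ^ 4\<close> (\<open>ljunggren_fourth_power\<close>), and \<open>v = 239 + \<i>\<close> is
  \<open>- (1 - \<i>) * (3 - 2 * \<i>) ^ 4\<close>. Hence the product of the principal fourth roots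
  \<open>\<gamma>\<close> of \<open>v\<close> and \<open>\<delta>\<close> of \<open>x + \<sigma> \<i>\<close> is \<open>r * h\<close> with a Gaussian integer \<open>h\<close> and a real number \<open>r\<close>
  that is the fourth root of \<open>2\<close> or its inverse (\<open>fourth_root_real_times_gauss_int\<close>).
  For large \<open>x\<close> the number \<open>\<delta>\<close> is almost real: the argument of \<open>\<delta>\<close> is about \<open>\<sigma> / (4 * x)\<close>.

  The diagonal Pade approximants of the function \<open>w powr (1/4)\<close> at \<open>w = 1\<close> provide numbers
  \<open>P\<^sub>n\<close> such that \<open>4 ^ n * P\<^sub>n\<close> is a Gaussian integer (\<open>pow4_times_pade_gauss_ints\<close>), that have
  absolute value at most \<open>960 ^ n\<close> (\<open>norm_pade_le\<close>), and for which \<open>\<gamma> * P\<^sub>n\<close> is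
  almost real, with imaginary part at most \<open>1 / (240 * 239 ^ n)\<close> (\<open>abs_Im_pade_239_le\<close>).
  The imaginary part of \<open>4 ^ n * (\<gamma> * P\<^sub>n) * \<delta> = r * (4 ^ n * P\<^sub>n * h)\<close> is then small,
  but it is \<open>r\<close> times an integer; so it vanishes, and \<open>P\<^sub>n * h\<close> is real. If
  \<open>x \<ge> 384 ^ 4\<close>, this happens for two consecutive \<open>n\<close> (\<open>exists_pade_index\<close>), and then
  \<open>P\<^sub>n\<close> times the conjugate of \<open>P\<^sub>n\<^sub>+\<^sub>1\<close> is real, which a three-term recurrence excludes
  (\<open>Im_pade_consecutive_neq_0\<close>).

  So \<open>x < 384 ^ 4\<close>. Since \<open>(x, y\<^sup>2)\<close> solves the Pell equation \<open>1 + x\<^sup>2 = 2 * z\<^sup>2\<close>, only the first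
  fourteen solutions of that equation remain, and among them \<open>z\<close> is a square exactly for
  \<open>z = 1\<close> and \<open>z = 169\<close>.
\<close>

section \<open>Pade approximants of a power function\<close>

text \<open>
  The homogeneous form \<open>(u - v) ^ n * J ((u + v) / (u - v))\<close> of the Jacobi polynomial \<open>J\<close> of
  degree \<open>n\<close> with parameters \<open>\<nu>\<close> and \<open>- \<nu>\<close>. In terms of \<open>w = u / v\<close>, the quotient of
  \<open>pade \<nu> n u v\<close> by \<open>pade \<nu> n v u\<close> is the diagonal Pade approximant of \<open>w powr \<nu>\<close> at \<open>w = 1\<close>.
\<close>
definition pade :: "real \<Rightarrow> nat \<Rightarrow> complex \<Rightarrow> complex \<Rightarrow> complex" where
  "pade \<nu> n u v =
     (\<Sum>j\<le>n. of_real (((real n - \<nu>) gchoose j) * ((real n + \<nu>) gchoose (n - j))) * u ^ (n - j) * v ^ j)"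

text \<open>
  The factor that turns the values of the primitive \<open>pade_prim\<close> at its two distinguished points into
  \<open>pade\<close> with its binomial coefficients (\<open>pade_prim_endpoint\<close>).
\<close>
definition pade_norm :: "real \<Rightarrow> nat \<Rightarrow> real" where
  "pade_norm \<nu> n = pochhammer (\<nu> - real n) (2 * n + 1) / (fact n)\<^sup>2"

text \<open>
  The termwise primitive of \<open>(s - u) ^ n * (s - v) ^ n * s powr (\<nu> - n - 1)\<close> after expanding both
  binomials. Since \<open>s powr \<nu>\<close> can be split off from every term, its values at \<open>u\<close> and \<open>v\<close> are \<open>u powr \<nu>\<close>
  and \<open>v powr \<nu>\<close> times polynomials in \<open>u\<close> and \<open>v\<close>, whereas their difference is the integral of a function
  with zeros of order \<open>n\<close> at both ends and hence small. This is the Pade property.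
\<close>
definition pade_prim :: "real \<Rightarrow> nat \<Rightarrow> complex \<Rightarrow> complex \<Rightarrow> complex \<Rightarrow> complex" where
  "pade_prim \<nu> n u v s =
     (\<Sum>j\<le>n. \<Sum>i\<le>n. of_nat (n choose j) * of_nat (n choose i) * (- u) ^ (n - j) * (- v) ^ (n - i)
        * s powr of_real (\<nu> - real n + real j + real i) / of_real (\<nu> - real n + real j + real i))"

text \<open>
  The partial fraction expansion of \<open>fact n / pochhammer c (n + 1)\<close>. By Pascal's rule the sum for
  \<open>n + 1\<close> is the difference of the sums for \<open>n\<close> at \<open>c\<close> and at \<open>c + 1\<close>.
\<close>
lemma sum_binomial_partial_fractions:
  fixes c :: real
  assumes "\<And>i. i \<le> n \<Longrightarrow> c + real i \<noteq> 0"
  shows "(\<Sum>i\<le>n. real (n choose i) * (-1) ^ i / (c + real i)) = fact n / pochhammer c (Suc n)"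
  using assms
proof (induction n arbitrary: c)
  case 0
  then show ?case by simp
next
  case (Suc n)
  let ?f = "\<lambda>n c i. real (n choose i) * (-1) ^ i / (c + real i)"
  have nz: "c \<noteq> 0" "c + 1 + real n \<noteq> 0"
    using Suc.prems[of 0] Suc.prems[of "Suc n"] by (auto simp: add_ac)
  have nz': "pochhammer (c + 1) n \<noteq> 0"
  proof
    assume "pochhammer (c + 1) n = 0"
    then obtain k where "k < n" "c + 1 = - real k" by (auto simp: pochhammer_eq_0_iff)
    with Suc.prems[of "Suc k"] show False by simp
  qed
  have "(\<Sum>i\<le>Suc n. ?f (Suc n) c i) = ?f (Suc n) c 0 + (\<Sum>i\<le>n. ?f (Suc n) c (Suc i))"
    by (rule sum.atMost_Suc_shift)
  also have "(\<Sum>i\<le>n. ?f (Suc n) c (Suc i)) = (\<Sum>i\<le>n. ?f n c (Suc i)) - (\<Sum>i\<le>n. ?f n (c + 1) i)"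
    unfolding sum_subtractf[symmetric]
    by (rule sum.cong) (simp_all add: add_divide_distrib ring_distribs add_ac diff_divide_distrib)
  also have "?f (Suc n) c 0 + ((\<Sum>i\<le>n. ?f n c (Suc i)) - (\<Sum>i\<le>n. ?f n (c + 1) i))
     = (\<Sum>i\<le>Suc n. ?f n c i) - (\<Sum>i\<le>n. ?f n (c + 1) i)"
    by (subst sum.atMost_Suc_shift) simp
  also have "(\<Sum>i\<le>Suc n. ?f n c i) = (\<Sum>i\<le>n. ?f n c i)" by simp
  also have "\<dots> = fact n / pochhammer c (Suc n)" by (rule Suc.IH) (use Suc.prems in simp)
  also have "(\<Sum>i\<le>n. ?f n (c + 1) i) = fact n / pochhammer (c + 1) (Suc n)"
    by (rule Suc.IH) (use Suc.prems[of "Suc _"] in \<open>simp add: add_ac\<close>)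
  also have "fact n / pochhammer c (Suc n) - fact n / pochhammer (c + 1) (Suc n)
     = fact (Suc n) / pochhammer c (Suc (Suc n))"
  proof -
    have "pochhammer c (Suc n) = c * pochhammer (c + 1) n" by (simp add: pochhammer_rec)
    moreover have "pochhammer (c + 1) (Suc n) = pochhammer (c + 1) n * (c + 1 + real n)"
      by (simp add: pochhammer_Suc)
    moreover have "pochhammer c (Suc (Suc n)) = c * (pochhammer (c + 1) n * (c + 1 + real n))"
      by (subst pochhammer_rec, subst pochhammer_Suc) simp
    ultimately show ?thesis using nz nz' by (simp add: divide_simps) (simp add: algebra_simps)
  qed
  finally show ?case .
qed

lemma non_Ints_add_nat_neq_0:
  fixes \<nu> :: real
  assumes "\<nu> \<notin> \<int>"
  shows "\<nu> - real n + real j + real i \<noteq> 0"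
proof
  assume "\<nu> - real n + real j + real i = 0"
  then have "\<nu> = real_of_int (int n - int j - int i)" by simp
  with assms show False by (metis Ints_of_int)
qed

text \<open>
  The product \<open>pochhammer (\<nu> - n) (2 * n + 1)\<close> in \<open>pade_norm\<close> contains the denominator as a
  consecutive block of factors; the blocks before and after it are the two binomial coefficients.
\<close>
lemma pade_norm_coeff:
  assumes "\<nu> \<notin> \<int>" and "j \<le> n"
  shows "pade_norm \<nu> n * real (n choose j) * (-1) ^ j * (fact n / pochhammer (\<nu> - real n + real j) (Suc n))
    = ((real n - \<nu>) gchoose j) * ((real n + \<nu>) gchoose (n - j))"
proof -
  have a: "pochhammer (\<nu> - real n) (2 * n + 1) =
      pochhammer (\<nu> - real n) j * pochhammer (\<nu> - real n + real j) (2 * n + 1 - j)"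
    using assms by (intro pochhammer_product) simp
  have b: "pochhammer (\<nu> - real n + real j) (2 * n + 1 - j) =
      pochhammer (\<nu> - real n + real j) (Suc n) * pochhammer (\<nu> - real n + real j + real (Suc n)) (n - j)"
    using assms by (subst pochhammer_product[of "Suc n"]) (auto simp: Suc_diff_le)
  have c: "pochhammer (\<nu> - real n + real j) (Suc n) \<noteq> 0"
  proof
    assume "pochhammer (\<nu> - real n + real j) (Suc n) = 0"
    then obtain k where "\<nu> - real n + real j = - real k" by (auto simp: pochhammer_eq_0_iff)
    then show False using non_Ints_add_nat_neq_0[OF assms(1), of n j k] by simp
  qed
  have d: "(real n - \<nu>) gchoose j = (-1) ^ j * pochhammer (\<nu> - real n) j / fact j"
    by (simp add: gbinomial_pochhammer)
  have e: "(real n + \<nu>) gchoose (n - j) = pochhammer (\<nu> - real n + real j + real (Suc n)) (n - j) / fact (n - j)"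
    using assms by (simp add: gbinomial_pochhammer' of_nat_diff algebra_simps)
  have f: "real (n choose j) = fact n / (fact j * fact (n - j))"
    using assms by (simp add: binomial_fact)
  show ?thesis unfolding pade_norm_def a b d e f using c by (simp add: power2_eq_square)
qed

text \<open>
  Passing from \<open>n - 1\<close> to \<open>n\<close> multiplies by \<open>(\<nu>\<^sup>2 - n\<^sup>2) / n\<^sup>2\<close>, of absolute value at most \<open>1\<close>.
\<close>
lemma abs_pade_norm_le:
  assumes "0 < \<nu>" "\<nu> < 1"
  shows "\<bar>pade_norm \<nu> n\<bar> \<le> \<nu>"
proof (induction n)
  case 0
  then show ?case using assms by (simp add: pade_norm_def)
next
  case (Suc n)
  have "pochhammer (\<nu> - real (Suc n)) (2 * Suc n + 1) =
     (\<nu> - real (Suc n)) * (pochhammer (\<nu> - real n) (2 * n + 1) * (\<nu> + real (Suc n)))"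
  proof -
    have "pochhammer (\<nu> - real (Suc n)) (2 * Suc n + 1) =
       (\<nu> - real (Suc n)) * pochhammer (\<nu> - real (Suc n) + 1) (Suc (2 * n + 1))"
      by (simp add: pochhammer_rec)
    also have "\<nu> - real (Suc n) + 1 = \<nu> - real n" by simp
    also have "pochhammer (\<nu> - real n) (Suc (2 * n + 1)) =
        pochhammer (\<nu> - real n) (2 * n + 1) * (\<nu> - real n + real (2 * n + 1))"
      by (rule pochhammer_Suc)
    also have "\<nu> - real n + real (2 * n + 1) = \<nu> + real (Suc n)" by simp
    finally show ?thesis .
  qed
  then have eq: "pade_norm \<nu> (Suc n) = pade_norm \<nu> n * ((\<nu> - real (Suc n)) * (\<nu> + real (Suc n)) / (real (Suc n))\<^sup>2)"
    by (simp add: pade_norm_def power_mult_distrib mult_ac del: of_nat_Suc)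
  have "\<nu>\<^sup>2 \<le> (real (Suc n))\<^sup>2" using assms by (intro power_mono) auto
  then have "\<bar>(\<nu> - real (Suc n)) * (\<nu> + real (Suc n))\<bar> \<le> (real (Suc n))\<^sup>2"
    by (simp add: algebra_simps power2_eq_square abs_if)
  then have "\<bar>(\<nu> - real (Suc n)) * (\<nu> + real (Suc n)) / (real (Suc n))\<^sup>2\<bar> \<le> 1" by simp
  then have "\<bar>pade_norm \<nu> (Suc n)\<bar> \<le> \<bar>pade_norm \<nu> n\<bar> * 1"
    unfolding eq abs_mult by (intro mult_left_mono) auto
  then show ?case using Suc by simp
qed

lemma pade_prim_commute: "pade_prim \<nu> n u v s = pade_prim \<nu> n v u s"
  unfolding pade_prim_def by (subst sum.swap) (simp add: mult_ac add_ac)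

lemma pade_prim_endpoint:
  assumes "\<nu> \<notin> \<int>" and "v \<noteq> 0"
  shows "of_real (pade_norm \<nu> n) * pade_prim \<nu> n u v v = v powr of_real \<nu> * pade \<nu> n u v"
proof -
  have pw: "v powr of_real (\<nu> - real n + real j + real i) = v powr of_real \<nu> * v ^ j * v ^ i / v ^ n" for i j
    using assms(2) by (simp add: powr_add powr_diff)
  have inner: "(\<Sum>i\<le>n. of_nat (n choose j) * of_nat (n choose i) * (- u) ^ (n - j) * (- v) ^ (n - i)
        * v powr of_real (\<nu> - real n + real j + real i) / of_real (\<nu> - real n + real j + real i))
     = v powr of_real \<nu> * u ^ (n - j) * v ^ j *
       of_real (real (n choose j) * (-1) ^ j * (fact n / pochhammer (\<nu> - real n + real j) (Suc n)))"
    if "j \<le> n" for j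
  proof -
    have "(\<Sum>i\<le>n. of_nat (n choose j) * of_nat (n choose i) * (- u) ^ (n - j) * (- v) ^ (n - i)
        * v powr of_real (\<nu> - real n + real j + real i) / of_real (\<nu> - real n + real j + real i))
      = (\<Sum>i\<le>n. v powr of_real \<nu> * u ^ (n - j) * v ^ j * of_real (real (n choose j) * (-1) ^ j) *
           of_real (real (n choose i) * (-1) ^ i / (\<nu> - real n + real j + real i)))"
    proof (rule sum.cong[OF refl])
      fix i assume "i \<in> {..n}"
      then have i: "i \<le> n" by simp
      have s1: "(- u) ^ (n - j) = (-1) ^ n * (-1) ^ j * u ^ (n - j)"
        using that by (subst power_minus) (simp add: minus_one_power_iff)
      have s2: "(- v) ^ (n - i) = (-1) ^ n * (-1) ^ i * v ^ (n - i)"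
        using i by (subst power_minus) (simp add: minus_one_power_iff)
      have s3: "v ^ n = v ^ (n - i) * v ^ i" using i by (simp flip: power_add)
      have s4: "(-1) ^ n * (-1) ^ n = (1::complex)" by (simp flip: power_mult_distrib)
      show "of_nat (n choose j) * of_nat (n choose i) * (- u) ^ (n - j) * (- v) ^ (n - i)
        * v powr of_real (\<nu> - real n + real j + real i) / of_real (\<nu> - real n + real j + real i)
        = v powr of_real \<nu> * u ^ (n - j) * v ^ j * of_real (real (n choose j) * (-1) ^ j) *
           of_real (real (n choose i) * (-1) ^ i / (\<nu> - real n + real j + real i))"
        unfolding pw s1 s2 s3 using assms(2) s4 by (simp add: mult_ac)
    qed
    also have "\<dots> = v powr of_real \<nu> * u ^ (n - j) * v ^ j * of_real (real (n choose j) * (-1) ^ j) *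
        of_real (\<Sum>i\<le>n. real (n choose i) * (-1) ^ i / (\<nu> - real n + real j + real i))"
      by (simp only: sum_distrib_left of_real_sum)
    also have "(\<Sum>i\<le>n. real (n choose i) * (-1) ^ i / (\<nu> - real n + real j + real i))
       = fact n / pochhammer (\<nu> - real n + real j) (Suc n)"
      by (rule sum_binomial_partial_fractions) (rule non_Ints_add_nat_neq_0[OF assms(1)])
    finally show ?thesis by (simp add: mult_ac)
  qed
  have "of_real (pade_norm \<nu> n) * pade_prim \<nu> n u v v =
     (\<Sum>j\<le>n. v powr of_real \<nu> * u ^ (n - j) * v ^ j *
       of_real (pade_norm \<nu> n * real (n choose j) * (-1) ^ j * (fact n / pochhammer (\<nu> - real n + real j) (Suc n))))"
    unfolding pade_prim_def sum_distrib_left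
    by (rule sum.cong[OF refl], subst sum_distrib_left[symmetric], subst inner) (simp_all add: mult_ac)
  also have "\<dots> = v powr of_real \<nu> * pade \<nu> n u v"
    unfolding pade_def sum_distrib_left
    by (rule sum.cong[OF refl], subst pade_norm_coeff) (use assms in \<open>simp_all add: mult_ac\<close>)
  finally show ?thesis .
qed

lemma pade_prim_has_derivative:
  assumes "\<nu> \<notin> \<int>" and "s \<notin> \<real>\<^sub>\<le>\<^sub>0"
  shows "(pade_prim \<nu> n u v has_field_derivative
            (s - u) ^ n * (s - v) ^ n * s powr of_real (\<nu> - real n - 1)) (at s within S)"
proof -
  have s: "s \<noteq> 0" using assms(2) by auto
  have pw: "s powr (of_real (\<nu> - real n + real j + real i) - 1) = s powr of_real (\<nu> - real n - 1) * s ^ j * s ^ i" for i j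
  proof -
    have "of_real (\<nu> - real n + real j + real i) - 1 = (of_real (\<nu> - real n - 1) + of_nat j + of_nat i :: complex)" by simp
    then show ?thesis using s by (simp only: powr_add powr_complexpow[OF s])
  qed
  have rearrange: "a * b * c * d * (w * x * y) = a * x * c * (b * y * d) * w" for a b c d w x y :: complex
    by (simp add: mult_ac)
  have binom: "(\<Sum>j\<le>n. of_nat (n choose j) * s ^ j * (- w) ^ (n - j)) = (s - w) ^ n" for w
  proof -
    have "(s - w) ^ n = (s + - w) ^ n" by simp
    also have "\<dots> = (\<Sum>j\<le>n. of_nat (n choose j) * s ^ j * (- w) ^ (n - j))" by (rule binomial_ring)
    finally show ?thesis by (rule sym)
  qed
  have cancel: "c * (a * x) / a = c * x" if "a \<noteq> 0" for a c x :: complex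
    using that by simp
  have "(pade_prim \<nu> n u v has_field_derivative
     (\<Sum>j\<le>n. \<Sum>i\<le>n. of_nat (n choose j) * of_nat (n choose i) * (- u) ^ (n - j) * (- v) ^ (n - i)
        * s powr (of_real (\<nu> - real n + real j + real i) - 1))) (at s within S)"
    unfolding pade_prim_def
  proof (intro DERIV_sum)
    fix j i
    let ?a = "\<nu> - real n + real j + real i"
    let ?c = "of_nat (n choose j) * of_nat (n choose i) * (- u) ^ (n - j) * (- v) ^ (n - i)"
    have "((\<lambda>s. ?c * s powr of_real ?a / of_real ?a) has_field_derivative
       ?c * (of_real ?a * s powr (of_real ?a - 1)) / of_real ?a) (at s within S)"
      by (intro DERIV_cdivide DERIV_cmult has_field_derivative_at_within[OF has_field_derivative_powr] assms)
    moreover have "(of_real ?a :: complex) \<noteq> 0"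
      using non_Ints_add_nat_neq_0[OF assms(1), of n j i] by (simp only: of_real_eq_0_iff not_False_eq_True)
    then have "?c * (of_real ?a * s powr (of_real ?a - 1)) / of_real ?a = ?c * s powr (of_real ?a - 1)"
      by (rule cancel)
    ultimately show "((\<lambda>s. ?c * s powr of_real ?a / of_real ?a) has_field_derivative
       ?c * s powr (of_real ?a - 1)) (at s within S)" by (rule subst[rotated])
  qed
  also have "(\<Sum>j\<le>n. \<Sum>i\<le>n. of_nat (n choose j) * of_nat (n choose i) * (- u) ^ (n - j) * (- v) ^ (n - i)
        * s powr (of_real (\<nu> - real n + real j + real i) - 1))
     = (\<Sum>j\<le>n. of_nat (n choose j) * s ^ j * (- u) ^ (n - j)) * (\<Sum>i\<le>n. of_nat (n choose i) * s ^ i * (- v) ^ (n - i))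
        * s powr of_real (\<nu> - real n - 1)"
    by (subst sum_product, subst sum_distrib_right, intro sum.cong refl, subst sum_distrib_right, intro sum.cong refl, subst pw)
      (rule rearrange)
  also have "\<dots> = (s - u) ^ n * (s - v) ^ n * s powr of_real (\<nu> - real n - 1)"
    by (simp only: binom)
  finally show ?thesis .
qed

text \<open>
  For conjugate points the two endpoint values are conjugate, so their difference is, up to
  the factor \<open>2 * \<i>\<close>, the imaginary part of one of them. On the vertical segment joining the points
  \<open>(s - cnj v) * (s - v)\<close> is real and lies in \<open>{0..1}\<close>, and \<open>norm s\<close> is at least \<open>a\<close>; thus the derivative of
  \<open>pade_prim\<close> is bounded and the mean value inequality suffices.
\<close>
lemma Im_pade_le:
  assumes nu: "0 < \<nu>" "\<nu> < 1" and a: "a > 0"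
    and v: "v = Complex a b" and b: "\<bar>b\<bar> \<le> 1"
  shows "\<bar>Im (v powr of_real \<nu> * pade \<nu> n (cnj v) v)\<bar> \<le> \<nu> * a powr (\<nu> - real n - 1)"
proof -
  let ?F = "pade_prim \<nu> n (cnj v) v" and ?S = "closed_segment (cnj v) v"
  have nI: "\<nu> \<notin> \<int>" 
  proof
    assume "\<nu> \<in> \<int>"
    then obtain k where "\<nu> = of_int k" by (auto elim: Ints_cases)
    with nu show False by simp
  qed
  have v0: "v \<noteq> 0" "cnj v \<noteq> 0" using v a by (auto simp: complex_eq_iff)
  have seg: "Re s = a \<and> \<bar>Im s\<bar> \<le> \<bar>b\<bar>" if "s \<in> ?S" for s
  proof -
    from that obtain t where t: "0 \<le> t" "t \<le> 1" "s = (1 - t) *\<^sub>R cnj v + t *\<^sub>R v"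
      by (auto simp: in_segment)
    have "Re s = a" unfolding t(3) v by (simp add: left_diff_distrib)
    moreover have "Im s = (2 * t - 1) * b" unfolding t(3) v by (simp add: algebra_simps)
    moreover have "\<bar>2 * t - 1\<bar> * \<bar>b\<bar> \<le> 1 * \<bar>b\<bar>" using t by (intro mult_right_mono) auto
    ultimately show ?thesis by (simp add: abs_mult)
  qed
  have "norm (?F v - ?F (cnj v)) \<le> a powr (\<nu> - real n - 1) * norm (v - cnj v)"
  proof (rule field_differentiable_bound)
    show "convex ?S" by simp
    fix s assume s: "s \<in> ?S"
    from seg[OF s] have Re: "Re s = a" and Im: "\<bar>Im s\<bar> \<le> \<bar>b\<bar>" by auto
    have "s \<notin> \<real>\<^sub>\<le>\<^sub>0" using Re a by (auto simp: complex_nonpos_Reals_iff)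
    then show "(?F has_field_derivative (s - cnj v) ^ n * (s - v) ^ n * s powr of_real (\<nu> - real n - 1)) (at s within ?S)"
      using nI by (rule pade_prim_has_derivative[rotated])
    have "(s - cnj v) * (s - v) = of_real (b\<^sup>2 - (Im s)\<^sup>2)"
      using Re v by (simp add: complex_eq_iff power2_eq_square algebra_simps)
    then have "norm ((s - cnj v) ^ n * (s - v) ^ n) = \<bar>b\<^sup>2 - (Im s)\<^sup>2\<bar> ^ n"
      by (simp add: power_mult_distrib[symmetric] norm_power del: of_real_diff)
    also have "\<dots> \<le> 1 ^ n"
    proof (intro power_mono)
      have "b\<^sup>2 \<le> 1" using b by (simp add: abs_square_le_1)
      moreover have "(Im s)\<^sup>2 \<le> b\<^sup>2" using Im by (simp add: abs_le_square_iff)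
      moreover have "0 \<le> (Im s)\<^sup>2" by simp
      ultimately show "\<bar>b\<^sup>2 - (Im s)\<^sup>2\<bar> \<le> 1" by linarith
    qed simp
    finally have 1: "norm ((s - cnj v) ^ n * (s - v) ^ n) \<le> 1" by simp
    have 2: "norm (s powr of_real (\<nu> - real n - 1)) \<le> a powr (\<nu> - real n - 1)"
    proof -
      have "norm (s powr of_real (\<nu> - real n - 1)) = norm s powr (\<nu> - real n - 1)"
        by (subst norm_powr_real_powr') auto
      also have "\<dots> \<le> a powr (\<nu> - real n - 1)"
        using nu a Re complex_Re_le_cmod[of s] by (intro powr_mono2') auto
      finally show ?thesis .
    qed
    show "norm ((s - cnj v) ^ n * (s - v) ^ n * s powr of_real (\<nu> - real n - 1)) \<le> a powr (\<nu> - real n - 1)"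
      unfolding norm_mult[of "(s - cnj v) ^ n * (s - v) ^ n"] using mult_mono[OF 1 2] by simp
  qed auto
  also have "norm (v - cnj v) \<le> 2" using b v by (simp add: complex_diff_cnj norm_mult)
  finally have bd: "norm (?F v - ?F (cnj v)) \<le> a powr (\<nu> - real n - 1) * 2" by (simp add: mult_left_mono)
  have e1: "of_real (pade_norm \<nu> n) * ?F v = v powr of_real \<nu> * pade \<nu> n (cnj v) v"
    by (rule pade_prim_endpoint[OF nI v0(1)])
  have "of_real (pade_norm \<nu> n) * ?F (cnj v) = cnj v powr of_real \<nu> * pade \<nu> n v (cnj v)"
    by (subst pade_prim_commute) (rule pade_prim_endpoint[OF nI v0(2)])
  also have "\<dots> = cnj (v powr of_real \<nu> * pade \<nu> n (cnj v) v)"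
    using v a by (simp add: pade_def cnj_powr complex_nonpos_Reals_iff)
  finally have e2: "of_real (pade_norm \<nu> n) * ?F (cnj v) = cnj (v powr of_real \<nu> * pade \<nu> n (cnj v) v)" .
  have ImD: "2 * \<bar>Im w\<bar> = norm (w - cnj w)" for w
    by (simp add: complex_diff_cnj norm_mult)
  have "2 * \<bar>Im (v powr of_real \<nu> * pade \<nu> n (cnj v) v)\<bar> =
      norm (v powr of_real \<nu> * pade \<nu> n (cnj v) v - cnj (v powr of_real \<nu> * pade \<nu> n (cnj v) v))"
    by (rule ImD)
  also have "\<dots> = norm (of_real (pade_norm \<nu> n) * (?F v - ?F (cnj v)))"
    by (simp add: e1 e2 right_diff_distrib)
  also have "\<dots> = \<bar>pade_norm \<nu> n\<bar> * norm (?F v - ?F (cnj v))" by (simp add: norm_mult)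
  also have "\<dots> \<le> \<nu> * (a powr (\<nu> - real n - 1) * 2)"
    using abs_pade_norm_le[OF nu] bd nu by (intro mult_mono) auto
  finally show ?thesis by simp
qed

section \<open>Expansion, size and independence of the approximants\<close>

lemma pade_coeff_Vandermonde:
  fixes x y :: real
  assumes "k \<le> n"
  shows "(\<Sum>j\<le>n. (x gchoose j) * (y gchoose (n - j)) * real (j choose k))
    = (x gchoose k) * ((x + y - real k) gchoose (n - k))"
proof -
  have "(\<Sum>j\<le>n. (x gchoose j) * (y gchoose (n - j)) * real (j choose k))
     = (\<Sum>j\<in>{k..n}. (x gchoose j) * (y gchoose (n - j)) * real (j choose k))"
    by (intro sum.mono_neutral_right) auto
  also have "\<dots> = (\<Sum>j\<in>{k..n}. (x gchoose k) * ((x - real k gchoose (j - k)) * (y gchoose (n - j))))"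
  proof (rule sum.cong[OF refl])
    fix j assume "j \<in> {k..n}"
    then have "(x gchoose j) * (real j gchoose k) = (x gchoose k) * (x - real k gchoose (j - k))"
      by (intro gbinomial_trinomial_revision) simp
    then show "(x gchoose j) * (y gchoose (n - j)) * real (j choose k)
        = (x gchoose k) * ((x - real k gchoose (j - k)) * (y gchoose (n - j)))"
      by (simp add: binomial_gbinomial mult_ac)
  qed
  also have "\<dots> = (\<Sum>i\<in>{0..n - k}. (x gchoose k) * ((x - real k gchoose i) * (y gchoose (n - k - i))))"
    using assms by (intro sum.reindex_bij_witness[of _ "\<lambda>i. i + k" "\<lambda>j. j - k"]) (auto simp: add.commute)
  also have "\<dots> = (x gchoose k) * ((x - real k + y) gchoose (n - k))"
    by (simp only: sum_distrib_left[symmetric] gbinomial_Vandermonde)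
  also have "x - real k + y = x + y - real k" by simp
  finally show ?thesis .
qed

text \<open>
  Expanding in powers of \<open>v - u\<close> reveals better denominators than the definition: the remaining
  denominator is that of the binomial coefficient with index \<open>k\<close>, and the accompanying power \<open>(v - u) ^ k\<close>
  cancels a part of it when \<open>v - u\<close> is even. The recurrence below also becomes a relation between only four
  coefficients.
\<close>
lemma pade_diff_expansion:
  "pade \<nu> n u v = (\<Sum>k\<le>n. of_real (((real n - \<nu>) gchoose k) * real ((2 * n - k) choose n)) * (v - u) ^ k * u ^ (n - k))"
proof -
  let ?a = "\<lambda>j. ((real n - \<nu>) gchoose j) * ((real n + \<nu>) gchoose (n - j))"
  have "pade \<nu> n u v = (\<Sum>j\<le>n. \<Sum>k\<le>n. of_real (?a j * real (j choose k)) * (v - u) ^ k * u ^ (n - k))"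
    unfolding pade_def
  proof (rule sum.cong[OF refl])
    fix j assume "j \<in> {..n}"
    then have j: "j \<le> n" by simp
    have "v ^ j = ((v - u) + u) ^ j" by simp
    also have "\<dots> = (\<Sum>k\<le>j. of_nat (j choose k) * (v - u) ^ k * u ^ (j - k))" by (rule binomial_ring)
    finally have "of_real (?a j) * u ^ (n - j) * v ^ j = 
       (\<Sum>k\<le>j. of_real (?a j) * u ^ (n - j) * (of_nat (j choose k) * (v - u) ^ k * u ^ (j - k)))"
      by (simp only: sum_distrib_left)
    also have "\<dots> = (\<Sum>k\<le>j. of_real (?a j * real (j choose k)) * (v - u) ^ k * u ^ (n - k))"
    proof (rule sum.cong[OF refl])
      fix k assume "k \<in> {..j}"
      then have "u ^ (n - k) = u ^ (n - j) * u ^ (j - k)" using j by (simp flip: power_add)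
      then show "of_real (?a j) * u ^ (n - j) * (of_nat (j choose k) * (v - u) ^ k * u ^ (j - k))
          = of_real (?a j * real (j choose k)) * (v - u) ^ k * u ^ (n - k)"
        by (simp add: mult_ac)
    qed
    also have "\<dots> = (\<Sum>k\<le>n. of_real (?a j * real (j choose k)) * (v - u) ^ k * u ^ (n - k))"
      using j by (intro sum.mono_neutral_left) (auto simp: binomial_eq_0)
    finally show "of_real (?a j) * u ^ (n - j) * v ^ j
        = (\<Sum>k\<le>n. of_real (?a j * real (j choose k)) * (v - u) ^ k * u ^ (n - k))" .
  qed
  also have "\<dots> = (\<Sum>k\<le>n. \<Sum>j\<le>n. of_real (?a j * real (j choose k)) * (v - u) ^ k * u ^ (n - k))"
    by (rule sum.swap)
  also have "\<dots> = (\<Sum>k\<le>n. of_real (((real n - \<nu>) gchoose k) * real ((2 * n - k) choose n)) * (v - u) ^ k * u ^ (n - k))"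
  proof (rule sum.cong[OF refl])
    fix k assume "k \<in> {..n}"
    then have k: "k \<le> n" by simp
    have "(\<Sum>j\<le>n. ?a j * real (j choose k)) = ((real n - \<nu>) gchoose k) * ((real (2 * n - k)) gchoose (n - k))"
      using pade_coeff_Vandermonde[OF k, of "real n - \<nu>" "real n + \<nu>"] k by (simp add: of_nat_diff)
    also have "(real (2 * n - k)) gchoose (n - k) = real ((2 * n - k) choose n)"
      unfolding binomial_gbinomial[symmetric] using binomial_symmetric[of n "2 * n - k"] k by simp
    finally show "(\<Sum>j\<le>n. of_real (?a j * real (j choose k)) * (v - u) ^ k * u ^ (n - k))
      = of_real (((real n - \<nu>) gchoose k) * real ((2 * n - k) choose n)) * (v - u) ^ k * u ^ (n - k)"
      by (simp only: sum_distrib_right[symmetric] of_real_sum[symmetric])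
  qed
  finally show ?thesis .
qed

text \<open>
  All the binomial coefficients involved are rational multiples of
  \<open>(n - \<nu> - 1) gchoose l\<close> and \<open>(2 * m - l) choose m\<close>; after dividing by these two numbers the claim is an
  identity of rational functions in \<open>\<nu>\<close>, \<open>m\<close> and \<open>l\<close>.
\<close>
lemma pade_coeff_recurrence:
  fixes \<nu> :: real
  assumes n: "n = Suc m" and l: "l \<le> m"
  defines "c \<equiv> \<lambda>n k. ((real n - \<nu>) gchoose k) * real ((2 * n - k) choose n)"
  shows "real n * (real n + 1) * c (Suc n) (Suc (Suc l)) =
     (2 * real n + 1) * real n * (2 * c n (Suc (Suc l)) + c n (Suc l)) - ((real n)\<^sup>2 - \<nu>\<^sup>2) * c m l"
proof -
  define x where "x = real n - \<nu>"
  define q where "q = 2 * m - l"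
  have q: "real q = 2 * real m - real l" using l by (simp add: q_def of_nat_diff)
  define g where "g = (x - 1) gchoose l"
  define h where "h = real (q choose m)"
  have g1: "(real l + 1) * (x gchoose Suc l) = x * g"
    using gbinomial_absorption[of l x] by (simp add: g_def add.commute)
  have g2: "(real l + 2) * ((x + 1) gchoose Suc (Suc l)) = (x + 1) * (x gchoose Suc l)"
    using Suc_times_gbinomial[of "Suc l" x] by (simp add: add.commute)
  have g3: "(x gchoose Suc (Suc l)) = ((x + 1) gchoose Suc (Suc l)) - (x gchoose Suc l)"
    using gbinomial_Suc_Suc[of x "Suc l"] by simp
  have h1: "(real m + 1) * real (Suc q choose Suc m) = (real q + 1) * h"
  proof -
    have "real (Suc m) * real (Suc q choose Suc m) = real (Suc q) * h"
      unfolding h_def using Suc_times_binomial[of m q] by (simp only: of_nat_mult[symmetric])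
    then show ?thesis by (simp add: add.commute)
  qed
  have h2: "(real m + 2) * real (Suc (Suc q) choose Suc (Suc m)) = (real q + 2) * real (Suc q choose Suc m)"
  proof -
    have "real (Suc (Suc m)) * real (Suc (Suc q) choose Suc (Suc m)) = real (Suc (Suc q)) * real (Suc q choose Suc m)"
      using Suc_times_binomial[of "Suc m" "Suc q"] by (simp only: of_nat_mult[symmetric])
    then show ?thesis by (simp add: add.commute del: binomial_Suc_Suc)
  qed
  have h3: "real (q choose Suc m) = real (Suc q choose Suc m) - h"
    by (simp add: h_def)
  have c1: "c (Suc n) (Suc (Suc l)) = ((x + 1) gchoose Suc (Suc l)) * real (Suc (Suc q) choose Suc (Suc m))"
  proof -
    have "2 * Suc n - Suc (Suc l) = Suc (Suc q)" using l by (simp add: n q_def)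
    moreover have "real (Suc n) - \<nu> = x + 1" by (simp add: x_def)
    ultimately show ?thesis unfolding c_def by (simp only: n)
  qed
  have c2: "c n (Suc (Suc l)) = (x gchoose Suc (Suc l)) * real (q choose Suc m)"
    by (simp add: c_def x_def n q_def)
  have c3: "c n (Suc l) = (x gchoose Suc l) * real (Suc q choose Suc m)"
  proof -
    have "2 * n - Suc l = Suc q" using l by (simp add: n q_def)
    then show ?thesis by (simp add: c_def x_def n del: binomial_Suc_Suc)
  qed
  have c4: "c m l = g * h"
    by (simp add: c_def g_def h_def x_def n q_def)
  define L where "L = real l"
  define M where "M = real m"
  have pos: "L + 1 > 0" "L + 2 > 0" "M + 1 > 0" "M + 2 > 0" by (auto simp: L_def M_def)
  have eq_divideI: "a = b / c" if "c * a = b" "c > 0" for a b c :: real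
    using that by (auto simp: field_simps)
  have e1: "(x gchoose Suc l) = x * g / (L + 1)"
    using g1 pos(1) unfolding L_def by (rule eq_divideI)
  have e2: "((x + 1) gchoose Suc (Suc l)) = (x + 1) * (x * g / (L + 1)) / (L + 2)"
    using g2 pos(2) unfolding e1 unfolding L_def by (rule eq_divideI)
  have e3: "real (Suc q choose Suc m) = (2 * M - L + 1) * h / (M + 1)"
    using h1 pos(3) unfolding q M_def L_def by (rule eq_divideI)
  have e4: "real (Suc (Suc q) choose Suc (Suc m)) = (2 * M - L + 2) * ((2 * M - L + 1) * h / (M + 1)) / (M + 2)"
    using h2 pos(4) unfolding q e3 unfolding M_def L_def by (rule eq_divideI)
  have nu: "\<nu> = M + 1 - x" and rn: "real n = M + 1" by (simp_all add: x_def n M_def)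
  show ?thesis
    unfolding c1 c2 c3 c4 g3 h3 e4 e3 e2 e1 rn
    unfolding nu using pos
    by (simp add: divide_simps) (simp add: algebra_simps power2_eq_square)
qed

text \<open>
  The three-term recurrence of the Jacobi polynomials, in homogeneous form.
\<close>
lemma pade_recurrence:
  assumes n: "n = Suc m"
  shows "of_real (real n * (real n + 1)) * pade \<nu> (Suc n) u v =
     of_real ((2 * real n + 1) * real n) * (u + v) * pade \<nu> n u v
     - of_real ((real n)\<^sup>2 - \<nu>\<^sup>2) * (v - u)\<^sup>2 * pade \<nu> m u v"
proof -
  define c where "c = (\<lambda>n k. ((real n - \<nu>) gchoose k) * real ((2 * n - k) choose n))"
  define d where "d = v - u"
  have pd: "pade \<nu> k u v = (\<Sum>i\<le>k. of_real (c k i) * d ^ i * u ^ (k - i))" for k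
    unfolding pade_diff_expansion c_def d_def ..
  let ?t = "\<lambda>i. d ^ i * u ^ (Suc n - i)"
  \<comment> \<open>Coefficients shifted by the multiplication with \<open>d\<close> and with \<open>d\<^sup>2\<close>.\<close>
  define c1 where "c1 = (\<lambda>k. case k of 0 \<Rightarrow> 0 | Suc i \<Rightarrow> c n i)"
  define c2 where "c2 = (\<lambda>k. case k of 0 \<Rightarrow> 0 | Suc i \<Rightarrow> (case i of 0 \<Rightarrow> 0 | Suc i \<Rightarrow> c m i))"
  have s0: "u * pade \<nu> n u v = (\<Sum>i\<le>Suc n. of_real (c n i) * ?t i)"
  proof -
    \<comment> \<open>For \<open>n > 0\<close> the coefficient with index \<open>n + 1\<close> vanishes, so all sums can run up to \<open>n + 1\<close>.\<close>
    have "c n (Suc n) = 0" by (simp add: c_def n binomial_eq_0)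
    then have "(\<Sum>i\<le>Suc n. of_real (c n i) * ?t i) = (\<Sum>i\<le>n. of_real (c n i) * ?t i)" by simp
    also have "\<dots> = u * pade \<nu> n u v" unfolding pd sum_distrib_left
      by (rule sum.cong) (auto simp: Suc_diff_le mult_ac)
    finally show ?thesis ..
  qed
  have s1: "d * pade \<nu> n u v = (\<Sum>i\<le>Suc n. of_real (c1 i) * ?t i)"
    unfolding sum.atMost_Suc_shift pd sum_distrib_left by (simp add: c1_def mult_ac)
  have s2: "d\<^sup>2 * pade \<nu> m u v = (\<Sum>i\<le>Suc n. of_real (c2 i) * ?t i)"
    unfolding n sum.atMost_Suc_shift pd sum_distrib_left by (simp add: c2_def mult_ac power2_eq_square)
  have key: "real n * (real n + 1) * c (Suc n) i =
     (2 * real n + 1) * real n * (2 * c n i + c1 i) - ((real n)\<^sup>2 - \<nu>\<^sup>2) * c2 i" if "i \<le> Suc n" for i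
  proof -
    have cb: "(real n + 1) * real (Suc (2 * n) choose n) = (2 * real n + 1) * real ((2 * n) choose n)"
    proof -
      have "Suc n * (Suc (2 * n) choose Suc n) = Suc (2 * n) * ((2 * n) choose n)"
        by (rule Suc_times_binomial)
      moreover have "Suc (2 * n) choose Suc n = Suc (2 * n) choose n"
        using binomial_symmetric[of n "Suc (2 * n)"] by (simp add: Suc_diff_le del: binomial_Suc_Suc)
      ultimately have "real (Suc n * (Suc (2 * n) choose n)) = real (Suc (2 * n) * ((2 * n) choose n))"
        by (simp only:)
      then show ?thesis by (simp add: algebra_simps del: binomial_Suc_Suc)
    qed
    have cb2: "Suc (2 * n) choose Suc n = Suc (2 * n) choose n"
        using binomial_symmetric[of n "Suc (2 * n)"] by (simp add: Suc_diff_le del: binomial_Suc_Suc)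
    consider "i = 0" | "i = 1" | l where "i = Suc (Suc l)" "l \<le> m"
    proof (cases i)
      case 0
      then show ?thesis by (rule that)
    next
      case (Suc i')
      then show ?thesis using that \<open>i \<le> Suc n\<close> n by (cases i') auto
    qed
    then show ?thesis
    proof cases
      case 1
      have "2 * Suc n choose Suc n = 2 * (Suc (2 * n) choose n)"
        using cb2 by simp
      then have "c (Suc n) 0 = 2 * real (Suc (2 * n) choose n)" by (simp add: c_def del: binomial_Suc_Suc)
      then have "real n * (real n + 1) * c (Suc n) 0 = real n * 2 * ((real n + 1) * real (Suc (2 * n) choose n))"
        by (simp only: mult_ac)
      also have "\<dots> = (2 * real n + 1) * real n * (2 * c n 0 + c1 0) - ((real n)\<^sup>2 - \<nu>\<^sup>2) * c2 0"
        unfolding cb by (simp add: c_def c1_def c2_def)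
      finally show ?thesis unfolding 1 .
    next
      case 2
      define N where "N = real n"
      define h where "h = real ((2 * n - 1) choose n)"
      have "2 * n choose n = 2 * ((2 * n - 1) choose n)"
        using binomial_symmetric[of m "Suc (2 * m)"] n by (simp add: Suc_diff_le)
      then have h: "real (2 * n choose n) = 2 * h" by (simp add: h_def)
      have a: "c (Suc n) 1 = (N + 1 - \<nu>) * real (Suc (2 * n) choose n)"
        using cb2 by (simp add: c_def N_def add_ac del: binomial_Suc_Suc)
      have b: "c n 1 = (N - \<nu>) * h" by (simp add: c_def N_def h_def)
      have e: "c1 1 = 2 * h" "c2 1 = 0" using h by (simp_all add: c1_def c2_def c_def)
      have f: "(N + 1) * real (Suc (2 * n) choose n) = (2 * N + 1) * (2 * h)" using cb unfolding h N_def .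
      have "real n * (real n + 1) * c (Suc n) i = N * (N + 1 - \<nu>) * ((N + 1) * real (Suc (2 * n) choose n))"
        unfolding 2 a N_def by (simp add: mult_ac del: binomial_Suc_Suc)
      also have "\<dots> = (2 * N + 1) * N * (2 * c n 1 + c1 1) - (N\<^sup>2 - \<nu>\<^sup>2) * c2 1"
        unfolding f b e by (simp add: algebra_simps)
      finally show ?thesis unfolding 2 N_def .
    next
      case 3
      show ?thesis using pade_coeff_recurrence[OF n 3(2), of \<nu>] unfolding 3 c1_def c2_def c_def by simp
    qed
  qed
  have "of_real (real n * (real n + 1)) * pade \<nu> (Suc n) u v =
     (\<Sum>i\<le>Suc n. of_real (real n * (real n + 1) * c (Suc n) i) * ?t i)"
    unfolding pd sum_distrib_left by (rule sum.cong) (simp_all add: mult_ac)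
  also have "\<dots> = (\<Sum>i\<le>Suc n. of_real ((2 * real n + 1) * real n * (2 * c n i + c1 i) - ((real n)\<^sup>2 - \<nu>\<^sup>2) * c2 i) * ?t i)"
    by (rule sum.cong) (simp_all only: key atMost_iff)
  also have "\<dots> = (\<Sum>i\<le>Suc n. of_real ((2 * real n + 1) * real n) * (2 * (of_real (c n i) * ?t i) + of_real (c1 i) * ?t i)
       - of_real ((real n)\<^sup>2 - \<nu>\<^sup>2) * (of_real (c2 i) * ?t i))"
    by (rule sum.cong) (simp_all add: algebra_simps)
  also have "\<dots> = of_real ((2 * real n + 1) * real n) * (2 * (u * pade \<nu> n u v) + d * pade \<nu> n u v)
      - of_real ((real n)\<^sup>2 - \<nu>\<^sup>2) * (d\<^sup>2 * pade \<nu> m u v)"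
    unfolding s0 s1 s2 sum_subtractf sum_distrib_left[symmetric] sum.distrib ..
  also have "\<dots> = of_real ((2 * real n + 1) * real n) * (u + v) * pade \<nu> n u v
     - of_real ((real n)\<^sup>2 - \<nu>\<^sup>2) * (v - u)\<^sup>2 * pade \<nu> m u v"
    unfolding d_def by algebra
  finally show ?thesis .
qed

text \<open>
  For conjugate arguments the recurrence has real coefficients, because \<open>u + v\<close> and \<open>(v - u)\<^sup>2\<close> are real.
  Hence the imaginary part for \<open>n\<close> is a nonzero real multiple of the one for \<open>n - 1\<close>. This plays the role of
  the nonvanishing determinant of consecutive Pade approximants.
\<close>
lemma Im_pade_consecutive_neq_0:
  assumes nu: "\<nu> \<notin> \<int>" and v: "Im v \<noteq> 0"
  shows "Im (pade \<nu> n (cnj v) v * cnj (pade \<nu> (Suc n) (cnj v) v)) \<noteq> 0"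
proof (induction n)
  case 0
  have "\<nu> \<noteq> 0" using nu by auto
  then show ?case using v by (simp add: pade_def algebra_simps)
next
  case (Suc m)
  define n where "n = Suc m"
  define P where "P = (\<lambda>k. pade \<nu> k (cnj v) v)"
  define r where "r = (2 * real n + 1) * real n * (2 * Re v)"
  define t where "t = ((real n)\<^sup>2 - \<nu>\<^sup>2) * (2 * Im v)\<^sup>2"
  have "(real n)\<^sup>2 \<noteq> \<nu>\<^sup>2"
    using nu by (metis Ints_minus Ints_of_nat power2_eq_iff)
  then have t: "t \<noteq> 0" using v by (simp add: t_def)
  have uv: "cnj v + v = of_real (2 * Re v)" "(v - cnj v)\<^sup>2 = - of_real ((2 * Im v)\<^sup>2)"
    by (simp_all add: complex_eq_iff power2_eq_square)
  have "of_real (real n * (real n + 1)) * P (Suc n) = of_real r * P n + of_real t * P m"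
    using pade_recurrence[OF n_def, of \<nu> "cnj v" v] unfolding uv P_def r_def t_def
    by (simp add: algebra_simps)
  then have "cnj (of_real (real n * (real n + 1)) * P (Suc n)) = cnj (of_real r * P n + of_real t * P m)" 
    by (rule arg_cong)
  then have "P n * (of_real (real n * (real n + 1)) * cnj (P (Suc n))) = P n * (of_real r * cnj (P n) + of_real t * cnj (P m))"
    by simp
  then have "Im (P n * (of_real (real n * (real n + 1)) * cnj (P (Suc n)))) = Im (P n * (of_real r * cnj (P n) + of_real t * cnj (P m)))"
    by (rule arg_cong)
  then have "real n * (real n + 1) * Im (P n * cnj (P (Suc n))) = - t * Im (P m * cnj (P n))"
    by (simp add: algebra_simps)
  moreover have "- t * Im (P m * cnj (P n)) \<noteq> 0" using t Suc unfolding P_def n_def by simp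
  ultimately show ?case unfolding n_def P_def by auto
qed

text \<open>
  The coefficients in the definition are nonnegative and, by Vandermonde, sum to \<open>(2 * n) choose n\<close>.
\<close>
lemma norm_pade_le:
  assumes nu: "0 < \<nu>" "\<nu> < 1" and M: "norm u \<le> M" "norm v \<le> M"
  shows "norm (pade \<nu> n u v) \<le> (4 * M) ^ n"
proof -
  let ?a = "\<lambda>j. ((real n - \<nu>) gchoose j) * ((real n + \<nu>) gchoose (n - j))"
  have M0: "0 \<le> M" using M(1) norm_ge_zero order_trans by blast
  have a0: "0 \<le> ?a j" if "j \<le> n" for j
    using nu that unfolding gbinomial_pochhammer'
    by (intro mult_nonneg_nonneg divide_nonneg_nonneg pochhammer_nonneg) (auto simp: of_nat_diff)
  have "norm (pade \<nu> n u v) \<le> (\<Sum>j\<le>n. ?a j * M ^ n)"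
    unfolding pade_def
  proof (rule sum_norm_le)
    fix j assume "j \<in> {..n}"
    then have j: "j \<le> n" by simp
    have "norm u ^ (n - j) * norm v ^ j \<le> M ^ (n - j) * M ^ j"
      using M M0 by (intro mult_mono power_mono) auto
    also have "\<dots> = M ^ n" using j by (simp flip: power_add)
    finally have "?a j * (norm u ^ (n - j) * norm v ^ j) \<le> ?a j * M ^ n"
      using a0[OF j] by (rule mult_left_mono)
    moreover have "norm (of_real (?a j) * u ^ (n - j) * v ^ j) = ?a j * (norm u ^ (n - j) * norm v ^ j)"
      using a0[OF j] by (simp only: norm_mult norm_of_real norm_power abs_of_nonneg mult.assoc)
    ultimately show "norm (of_real (?a j) * u ^ (n - j) * v ^ j) \<le> ?a j * M ^ n" by simp
  qed
  also have "\<dots> = (\<Sum>j\<in>{0..n}. ?a j) * M ^ n" by (simp only: sum_distrib_right atMost_atLeast0)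
  also have "(\<Sum>j\<in>{0..n}. ?a j) = real (2 * n choose n)"
    by (simp add: gbinomial_Vandermonde binomial_gbinomial)
  also have "real (2 * n choose n) * M ^ n \<le> 4 ^ n * M ^ n"
  proof (rule mult_right_mono)
    have "real (2 * n choose n) \<le> real (2 ^ (2 * n))" using binomial_le_pow2 of_nat_mono by blast
    then show "real (2 * n choose n) \<le> 4 ^ n" by (simp add: power_mult)
  qed (use M0 in simp)
  finally show ?thesis by (simp add: power_mult_distrib)
qed

section \<open>Denominators of the binomial coefficients of a quarter\<close>

lemma fact_double: "\<exists>m::int. odd m \<and> fact (2 * j) = 2 ^ j * fact j * m"
proof (induction j)
  case 0
  show ?case by (intro exI[of _ 1]) simp
next
  case (Suc j)
  then obtain m :: int where m: "odd m" "fact (2 * j) = 2 ^ j * fact j * m" by blast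
  have "fact (2 * Suc j) = (2 * int j + 2) * ((2 * int j + 1) * (fact (2 * j) :: int))"
    by (simp add: algebra_simps)
  then have "fact (2 * Suc j) = 2 ^ Suc j * fact (Suc j) * (m * (2 * int j + 1))"
    unfolding m(2) by (simp add: algebra_simps)
  with m(1) show ?case by (intro exI[of _ "m * (2 * int j + 1)"]) simp
qed

text \<open>
  The exponent of \<open>2\<close> in a factorial is at most \<open>k\<close>: halving \<open>k\<close> by \<open>fact_double\<close> gives the induction.
\<close>
lemma fact_eq_pow2_times_odd: "\<exists>e\<le>k. \<exists>m::int. odd m \<and> fact k = 2 ^ e * m"
proof (induction k rule: less_induct)
  case (less k)
  have ev: "\<exists>e\<le>2 * j. \<exists>m::int. odd m \<and> fact (2 * j) = 2 ^ e * m" if "2 * j \<le> k" for j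
  proof (cases "j = 0")
    case True
    then show ?thesis by (intro exI[of _ 0] conjI exI[of _ 1]) auto
  next
    case False
    with that have "j < k" by simp
    from less.IH[OF this] obtain e and m :: int where e: "e \<le> j" "odd m" "fact j = 2 ^ e * m" by blast
    obtain m' :: int where m': "odd m'" "fact (2 * j) = 2 ^ j * fact j * m'" using fact_double by blast
    have "fact (2 * j) = 2 ^ (j + e) * (m * m')" unfolding m'(2) e(3) by (simp add: power_add)
    with e(1,2) m'(1) show ?thesis by (intro exI[of _ "j + e"] conjI exI[of _ "m * m'"]) auto
  qed
  show ?case
  proof (cases "even k")
    case True
    then obtain j where "k = 2 * j" by blast
    with ev[of j] show ?thesis by simp
  next
    case False
    then obtain j where k: "k = Suc (2 * j)" by (metis oddE Suc_eq_plus1)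
    obtain e and m :: int where e: "e \<le> 2 * j" "odd m" "fact (2 * j) = 2 ^ e * m"
      using ev[of j] k by auto
    have "fact k = 2 ^ e * (m * (2 * int j + 1))" using e(3) unfolding k by simp
    with e(1,2) k show ?thesis by (intro exI[of _ e] conjI exI[of _ "m * (2 * int j + 1)"]) auto
  qed
qed

text \<open>
  Modulo the odd part of \<open>fact k\<close> the number \<open>4\<close> is invertible, so there the progression with difference
  \<open>4\<close> is a unit multiple of \<open>k\<close> consecutive integers. The factor \<open>2 ^ k\<close> takes care of the powers of \<open>2\<close>.
\<close>
lemma fact_dvd_pow2_times_prod: "fact k dvd 2 ^ k * (\<Prod>i<k. a + 4 * int i)"
proof -
  obtain e and m :: int where e: "e \<le> k" "odd m" "fact k = 2 ^ e * m"
    using fact_eq_pow2_times_odd by blast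
  have "coprime (4::int) m" using e(2) coprime_power_left_iff[of 2 2 m] by simp
  then obtain c where c: "[4 * c = 1] (mod m)" using cong_solve_coprime_int by blast
  have "[a + 4 * int i = 4 * (c * a + int i)] (mod m)" for i
  proof -
    have "[a * 1 + 4 * int i = a * (4 * c) + 4 * int i] (mod m)"
      using c by (intro cong_add cong_mult cong_refl) (rule cong_sym)
    then show ?thesis by (simp add: algebra_simps)
  qed
  then have "[(\<Prod>i<k. a + 4 * int i) = (\<Prod>i<k. 4 * (c * a + int i))] (mod m)"
    by (intro cong_prod)
  moreover have "(\<Prod>i<k. 4 * (c * a + int i)) = 4 ^ k * pochhammer (c * a) k"
    unfolding prod.distrib by (simp add: pochhammer_prod atLeast0LessThan)
  moreover have "m dvd 4 ^ k * pochhammer (c * a) k"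
  proof -
    have "m dvd fact k" using e(3) by simp
    also have "fact k dvd pochhammer (c * a) k" by (rule fact_dvd_pochhammer)
    finally show ?thesis by (rule dvd_mult)
  qed
  ultimately have "m dvd (\<Prod>i<k. a + 4 * int i)" by (metis cong_dvd_iff)
  moreover have "(2::int) ^ e dvd 2 ^ k" using e(1) by (rule le_imp_power_dvd)
  ultimately show ?thesis unfolding e(3) by (rule mult_dvd_mono[rotated])
qed

lemma pow8_times_quarter_gbinomial_Ints:
  "8 ^ k * ((real_of_int a / 4) gchoose k) \<in> \<int>"
proof -
  define b where "b = a - 4 * int k + 4"
  have p: "pochhammer (real_of_int a / 4 - real k + 1) k * 4 ^ k = of_int (\<Prod>i<k. b + 4 * int i)"
  proof -
    have "pochhammer (real_of_int a / 4 - real k + 1) k * 4 ^ k = (\<Prod>i<k. (real_of_int a / 4 - real k + 1 + real i) * 4)"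
      unfolding prod.distrib by (simp add: pochhammer_prod atLeast0LessThan)
    also have "\<dots> = of_int (\<Prod>i<k. b + 4 * int i)"
      unfolding of_int_prod by (rule prod.cong) (simp_all add: b_def)
    finally show ?thesis .
  qed
  obtain c where c: "2 ^ k * (\<Prod>i<k. b + 4 * int i) = fact k * c"
    using fact_dvd_pow2_times_prod[of k b] by blast
  have "(8::real) ^ k = 2 ^ k * 4 ^ k" by (simp flip: power_mult_distrib)
  then have "8 ^ k * ((real_of_int a / 4) gchoose k) = 2 ^ k * (pochhammer (real_of_int a / 4 - real k + 1) k * 4 ^ k) / fact k"
    by (simp add: gbinomial_pochhammer')
  also have "\<dots> = of_int (2 ^ k * (\<Prod>i<k. b + 4 * int i)) / fact k" unfolding p by simp
  also have "\<dots> = of_int c" unfolding c by simp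
  finally show ?thesis by simp
qed

section \<open>Gaussian integers\<close>

definition gauss_ints :: "complex set" where
  "gauss_ints = {z. Re z \<in> \<int> \<and> Im z \<in> \<int>}"

lemma gauss_ints_Complex [simp]: "Complex (of_int a) (of_int b) \<in> gauss_ints"
  by (simp add: gauss_ints_def)

lemma gauss_ints_of_real: "x \<in> \<int> \<Longrightarrow> of_real x \<in> gauss_ints"
  by (simp add: gauss_ints_def)

lemma gauss_ints_1 [simp]: "1 \<in> gauss_ints" and gauss_ints_i [simp]: "\<i> \<in> gauss_ints"
  by (simp_all add: gauss_ints_def)

lemma gauss_ints_add: "x \<in> gauss_ints \<Longrightarrow> y \<in> gauss_ints \<Longrightarrow> x + y \<in> gauss_ints"
  and gauss_ints_mult: "x \<in> gauss_ints \<Longrightarrow> y \<in> gauss_ints \<Longrightarrow> x * y \<in> gauss_ints"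
  and gauss_ints_minus: "x \<in> gauss_ints \<Longrightarrow> - x \<in> gauss_ints"
  and gauss_ints_cnj: "x \<in> gauss_ints \<Longrightarrow> cnj x \<in> gauss_ints"
  by (auto simp: gauss_ints_def)

lemma gauss_ints_power: "x \<in> gauss_ints \<Longrightarrow> x ^ n \<in> gauss_ints"
  by (induction n) (auto intro: gauss_ints_mult)

lemma gauss_ints_sum: "(\<And>i. i \<in> A \<Longrightarrow> f i \<in> gauss_ints) \<Longrightarrow> sum f A \<in> gauss_ints"
proof (induction A rule: infinite_finite_induct)
  case (insert x F)
  then show ?case by (auto intro: gauss_ints_add)
qed (auto simp: gauss_ints_def)

text \<open>
  In the expansion in powers of \<open>v - u = 2 * \<i>\<close>, the factor \<open>4 ^ n * (2 * \<i>) ^ k\<close> supplies the power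
  \<open>8 ^ k\<close> that clears the denominator of the binomial coefficient.
\<close>
lemma pow4_times_pade_gauss_ints:
  assumes u: "u \<in> gauss_ints" and d: "v - u = 2 * \<i>"
  shows "4 ^ n * pade (1/4) n u v \<in> gauss_ints"
proof -
  have "4 ^ n * pade (1/4) n u v = (\<Sum>k\<le>n. of_real (8 ^ k * ((real n - 1/4) gchoose k)) *
      (of_real (4 ^ (n - k) * real ((2 * n - k) choose n)) * (\<i> ^ k * u ^ (n - k))))"
    unfolding pade_diff_expansion sum_distrib_left d
  proof (rule sum.cong[OF refl])
    fix k assume "k \<in> {..n}"
    then have "(4::complex) ^ n = 4 ^ (n - k) * 4 ^ k" by (simp flip: power_add)
    moreover have "(8::complex) ^ k = 4 ^ k * 2 ^ k" by (simp flip: power_mult_distrib)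
    ultimately show "4 ^ n * (of_real (((real n - 1/4) gchoose k) * real ((2 * n - k) choose n)) * (2 * \<i>) ^ k * u ^ (n - k))
      = of_real (8 ^ k * ((real n - 1/4) gchoose k)) *
      (of_real (4 ^ (n - k) * real ((2 * n - k) choose n)) * (\<i> ^ k * u ^ (n - k)))"
      by (simp add: power_mult_distrib mult_ac)
  qed
  also have "\<dots> \<in> gauss_ints"
  proof (intro gauss_ints_sum gauss_ints_mult gauss_ints_of_real gauss_ints_power u gauss_ints_i)
    fix k
    have "real n - 1/4 = of_int (4 * int n - 1) / 4" by simp
    then show "8 ^ k * ((real n - 1/4) gchoose k) \<in> \<int>"
      by (simp only: pow8_times_quarter_gbinomial_Ints)
    show "4 ^ (n - k) * real ((2 * n - k) choose n) \<in> \<int>" by (intro Ints_mult Ints_power) auto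
  qed
  finally show ?thesis .
qed

section \<open>Descent to a fourth power\<close>

text \<open>
  The halves of \<open>r + p\<close> and \<open>r - p\<close> are coprime with a square product, hence both are squares.
\<close>
lemma pythagorean_triple_param:
  fixes p q r :: int
  assumes cop: "coprime p q" and odd: "odd p" and eq: "p\<^sup>2 + q\<^sup>2 = r\<^sup>2" and r: "r > 0"
  obtains m n where "p = m\<^sup>2 - n\<^sup>2" "q = 2 * m * n" "r = m\<^sup>2 + n\<^sup>2"
proof -
  have sq: "x\<^sup>2 mod 4 = (if even x then 0 else 1)" for x :: int
  proof (cases "even x")
    case True
    then obtain k where "x = 2 * k" by blast
    then have "x\<^sup>2 = 4 * k\<^sup>2" by (simp add: power2_eq_square)
    then show ?thesis using True by simp
  next
    case False
    then obtain k where "x = 2 * k + 1" by (rule oddE)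
    then have "x\<^sup>2 = 1 + 4 * (k * k + k)" by (simp add: power2_eq_square algebra_simps)
    then have "x\<^sup>2 mod 4 = 1 mod 4" by (simp only: mod_mult_self2)
    then show ?thesis using False by simp
  qed
  have "even q"
  proof (rule ccontr)
    assume "odd q"
    then have "(p\<^sup>2 + q\<^sup>2) mod 4 = 2"
      using sq[of p] sq[of q] odd mod_add_eq[of "p\<^sup>2" 4 "q\<^sup>2"] by simp
    then show False using sq[of r] unfolding eq by (simp split: if_splits)
  qed
  then have "odd (r\<^sup>2)" using odd unfolding eq[symmetric] by simp
  then have "odd r" by simp
  obtain h where h: "q = 2 * h" using \<open>even q\<close> by blast
  obtain A where A: "r + p = 2 * A" using \<open>odd r\<close> odd by (metis evenE odd_even_add)
  obtain B where B: "r - p = 2 * B" using \<open>odd r\<close> odd by (metis evenE even_diff odd_even_add)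
  have rA: "r = A + B" and pA: "p = A - B" using A B by auto
  have AB: "A * B = h\<^sup>2"
  proof -
    have "4 * (A * B) = (r + p) * (r - p)" unfolding A B by simp
    also have "\<dots> = q\<^sup>2" using eq by (simp add: algebra_simps power2_eq_square)
    finally show ?thesis unfolding h by (simp add: power2_eq_square)
  qed
  have "\<bar>p\<bar> \<le> r"
  proof -
    have "p\<^sup>2 \<le> r\<^sup>2" using eq by (metis le_add_same_cancel1 zero_le_power2)
    then show ?thesis using r abs_le_square_iff[of p r] by simp
  qed
  then have nonneg: "A \<ge> 0" "B \<ge> 0" using A B by auto
  have copAB: "coprime A B"
  proof (rule coprimeI)
    fix d assume d: "d dvd A" "d dvd B"
    then have "d dvd p" unfolding pA by (rule dvd_diff)
    moreover have "d * d dvd h\<^sup>2" using d AB by (metis mult_dvd_mono)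
    then have "d dvd h" by (metis power2_eq_square pow_divides_pow_iff zero_less_numeral)
    then have "d dvd q" unfolding h by simp
    ultimately show "is_unit d" using cop by (meson coprime_common_divisor)
  qed
  have "is_nth_power 2 (nat A * nat B)"
  proof -
    have "nat A * nat B = nat (\<bar>h\<bar>\<^sup>2)" using AB nonneg by (simp add: nat_mult_distrib[symmetric])
    also have "\<dots> = (nat \<bar>h\<bar>) ^ 2" by (rule nat_power_eq) simp
    finally show ?thesis by (simp only: is_nth_power_nth_power)
  qed
  moreover have "coprime (nat A) (nat B)" using copAB nonneg by (simp add: coprime_int_iff[symmetric])
  ultimately have "is_nth_power 2 (nat A)" "is_nth_power 2 (nat B)"
    using is_nth_power_mult_coprime_nat_iff by blast+
  then obtain m n where "nat A = m ^ 2" "nat B = n ^ 2" by (metis is_nth_power_def)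
  then have m: "A = (int m)\<^sup>2" and n: "B = (int n)\<^sup>2" using nonneg by (metis int_nat_eq of_nat_power)+
  have "(int m * int n)\<^sup>2 = h\<^sup>2" using AB unfolding m n by (simp add: power_mult_distrib)
  then have "h = int m * int n \<or> h = int m * (- int n)" by (auto simp: power2_eq_iff)
  then show thesis
    using that[of "int m" "int n"] that[of "int m" "- int n"] pA rA h m n by auto
qed

text \<open>
  With \<open>x = 2 * k + 1\<close> the equation reads \<open>k\<^sup>2 + (k + 1)\<^sup>2 = (y\<^sup>2)\<^sup>2\<close>, a primitive Pythagorean triple whose
  hypotenuse is a square. Parametrising it exhibits \<open>y\<close> as the hypotenuse of another triple, and parametrising
  that one makes \<open>p + q \<i>\<close>, with \<open>p\<close> the odd and \<open>q\<close> the even number among \<open>k\<close> and \<open>k + 1\<close>, a fourth power up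
  to sign.
\<close>
lemma ljunggren_fourth_power:
  fixes x y :: int
  assumes x: "x > 0" and y: "y > 0" and eq: "1 + x\<^sup>2 = 2 * y ^ 4"
  obtains \<beta> \<sigma> \<epsilon> where "\<beta> \<in> gauss_ints" "\<sigma> \<in> {1, -1::real}" "\<epsilon> \<in> {1, -1::complex}"
    "Complex (of_int x) \<sigma> = \<epsilon> * (1 + \<i>) * \<beta> ^ 4"
proof -
  have "even (1 + x\<^sup>2)" unfolding eq by simp
  then have "odd x" by simp
  then obtain k where k: "x = 2 * k + 1" by (rule oddE)
  define p where "p = (if odd k then k else k + 1)"
  define q where "q = (if odd k then k + 1 else k)"
  have pq: "odd p" "p + q = x" "p - q = 1 \<or> p - q = -1"
    by (auto simp: p_def q_def k)
  have "p\<^sup>2 + q\<^sup>2 = k\<^sup>2 + (k + 1)\<^sup>2" by (simp add: p_def q_def)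
  also have "\<dots> = (y\<^sup>2)\<^sup>2" using eq unfolding k by (simp add: power2_eq_square power4_eq_xxxx algebra_simps)
  finally have ppq: "p\<^sup>2 + q\<^sup>2 = (y\<^sup>2)\<^sup>2" .
  have cop: "coprime p q"
  proof (rule coprimeI)
    fix d assume "d dvd p" "d dvd q"
    then have "d dvd p - q" by (rule dvd_diff)
    then show "is_unit d" using pq(3) by auto
  qed
  have "y\<^sup>2 > 0" using y by simp
  then obtain m n where mn: "p = m\<^sup>2 - n\<^sup>2" "q = 2 * m * n" "y\<^sup>2 = m\<^sup>2 + n\<^sup>2"
    by (rule pythagorean_triple_param[OF cop pq(1) ppq])
  have copmn: "coprime m n"
  proof (rule coprimeI)
    fix d assume d: "d dvd m" "d dvd n"
    then have "d dvd p" unfolding mn(1) by (simp add: power2_eq_square)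
    moreover have "d dvd q" unfolding mn(2) using d by simp
    ultimately show "is_unit d" using cop by (meson coprime_common_divisor)
  qed
  have pqc: "Complex p q = (Complex m n)\<^sup>2"
    by (simp add: complex_eq_iff mn power2_eq_square)
  have "\<exists>\<beta>\<in>gauss_ints. \<exists>\<epsilon>\<in>{1,-1}. Complex p q = \<epsilon> * \<beta> ^ 4"
  proof (cases "odd m")
    case True
    obtain a b where "m = a\<^sup>2 - b\<^sup>2" "n = 2 * a * b" "y = a\<^sup>2 + b\<^sup>2"
      by (rule pythagorean_triple_param[OF copmn True mn(3)[symmetric] y])
    then have "Complex m n = (Complex a b)\<^sup>2" by (simp add: complex_eq_iff power2_eq_square)
    then have "Complex p q = 1 * (Complex a b) ^ 4" unfolding pqc by (simp flip: power_mult)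
    then show ?thesis using gauss_ints_Complex by blast
  next
    case False
    then have odd: "odd n" using pq(1) unfolding mn by simp
    have cop': "coprime n m" using copmn by (simp add: coprime_commute)
    have eq': "n\<^sup>2 + m\<^sup>2 = y\<^sup>2" using mn(3) by simp
    obtain a b where "n = a\<^sup>2 - b\<^sup>2" "m = 2 * a * b" "y = a\<^sup>2 + b\<^sup>2"
      by (rule pythagorean_triple_param[OF cop' odd eq' y])
    \<comment> \<open>\<open>m + n \<i>\<close> is \<open>\<i>\<close> times the conjugate of \<open>n + m \<i>\<close>; squaring turns the factor \<open>\<i>\<close> into a sign.\<close>
    then have "Complex m n = \<i> * (Complex a (- b))\<^sup>2" by (simp add: complex_eq_iff power2_eq_square)
    then have "Complex p q = (- 1) * (Complex a (of_int (- b))) ^ 4" unfolding pqc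
      by (simp add: power_mult_distrib flip: power_mult)
    then show ?thesis using gauss_ints_Complex by blast
  qed
  then obtain \<beta> \<epsilon> where \<beta>: "\<beta> \<in> gauss_ints" "\<epsilon> \<in> {1, -1::complex}" "Complex p q = \<epsilon> * \<beta> ^ 4" by blast
  \<comment> \<open>\<open>p + q = x\<close> while \<open>p - q\<close> is \<open>1\<close> or \<open>- 1\<close>, so one factor \<open>1 + \<i>\<close> leads from \<open>p - q \<i>\<close> to \<open>x + \<sigma> \<i>\<close>.\<close>
  have "Complex x (of_int (p - q)) = (1 + \<i>) * cnj (Complex p q)"
    by (simp add: complex_eq_iff pq(2)[symmetric])
  also have "\<dots> = \<epsilon> * (1 + \<i>) * (cnj \<beta>) ^ 4" unfolding \<beta>(3) using \<beta>(2) by auto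
  finally have "Complex x (of_int (p - q)) = \<epsilon> * (1 + \<i>) * (cnj \<beta>) ^ 4" .
  moreover have "real_of_int (p - q) \<in> {1, -1}" using pq(3) by auto
  ultimately show thesis using that[of "cnj \<beta>" "of_int (p - q)" \<epsilon>] \<beta> gauss_ints_cnj by blast
qed

lemma fourth_power_eqD:
  fixes w c :: complex
  assumes "w ^ 4 = c ^ 4"
  shows "\<exists>\<eta>\<in>{1, -1, \<i>, -\<i>}. w = \<eta> * c"
proof -
  have "(w - c) * (w + c) * ((w - \<i> * c) * (w + \<i> * c)) = w ^ 4 - c ^ 4"
    by (simp add: algebra_simps power4_eq_xxxx)
  then have "w - c = 0 \<or> w + c = 0 \<or> w - \<i> * c = 0 \<or> w + \<i> * c = 0" using assms by simp
  then show ?thesis by (auto simp: eq_neg_iff_add_eq_0)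
qed

text \<open>
  A fourth root of \<open>2\<close> is real, and a fourth root of \<open>- 2\<close> is \<open>1 + \<i>\<close> divided by the real fourth root of
  \<open>2\<close>. The constant \<open>21/25\<close> is a lower bound for the inverse of the latter.
\<close>
lemma fourth_root_real_times_gauss_int:
  assumes g: "g \<in> gauss_ints" and \<epsilon>: "\<epsilon> \<in> {1, -1}" and w: "w ^ 4 = \<epsilon> * 2 * g ^ 4"
  obtains r h where "h \<in> gauss_ints" "r \<ge> (21/25::real)" "w = of_real r * h"
proof -
  define \<rho> where "\<rho> = root 4 2"
  have \<rho>4: "\<rho> ^ 4 = 2" by (simp add: \<rho>_def)
  have \<rho>0: "\<rho> > 0" by (simp add: \<rho>_def)
  have "\<rho> ^ 4 \<le> (119/100) ^ 4" unfolding \<rho>4 by (simp add: power4_eq_xxxx)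
  then have \<rho>u: "\<rho> \<le> 119/100" using \<rho>0 by (subst (asm) power_mono_iff) auto
  have "1 ^ 4 \<le> \<rho> ^ 4" unfolding \<rho>4 by simp
  then have \<rho>l: "1 \<le> \<rho>" using \<rho>0 by (subst (asm) power_mono_iff) auto
  have unit: "\<eta> * h \<in> gauss_ints" if "\<eta> \<in> {1, -1, \<i>, -\<i>}" "h \<in> gauss_ints" for \<eta> h
    using that by (auto intro!: gauss_ints_mult gauss_ints_minus simp: gauss_ints_minus)
  consider "\<epsilon> = 1" | "\<epsilon> = -1" using \<epsilon> by blast
  then show thesis
  proof cases
    case 1
    have "of_real \<rho> ^ 4 = (2::complex)" using \<rho>4 by (metis of_real_power of_real_numeral)
    then have "w ^ 4 = (of_real \<rho> * g) ^ 4" using w 1 by (simp add: power_mult_distrib)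
    then obtain \<eta> where "\<eta> \<in> {1, -1, \<i>, -\<i>}" "w = \<eta> * (of_real \<rho> * g)" using fourth_power_eqD by blast
    then show thesis using that[of "\<eta> * g" \<rho>] unit g \<rho>l by (simp add: mult_ac)
  next
    case 2
    have "(1 / \<rho>) ^ 4 = 1 / 2" unfolding power_one_over \<rho>4 ..
    then have "of_real (1 / \<rho>) ^ 4 = (of_real (1 / 2)::complex)" by (metis of_real_power)
    moreover have "(1 + \<i>) ^ 4 = -4" by (simp add: complex_eq_iff power4_eq_xxxx)
    ultimately have "(of_real (1 / \<rho>) * ((1 + \<i>) * g)) ^ 4 = of_real (1 / 2) * (-4 * g ^ 4)"
      by (simp only: power_mult_distrib)
    also have "\<dots> = w ^ 4" using w 2 by simp
    finally have "w ^ 4 = (of_real (1 / \<rho>) * ((1 + \<i>) * g)) ^ 4" by (rule sym)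
    then obtain \<eta> where \<eta>: "\<eta> \<in> {1, -1, \<i>, -\<i>}" "w = \<eta> * (of_real (1 / \<rho>) * ((1 + \<i>) * g))" using fourth_power_eqD by blast
    have "1 / \<rho> \<ge> 21/25" using \<rho>u \<rho>0 by (simp add: field_simps)
    moreover have "\<eta> * ((1 + \<i>) * g) \<in> gauss_ints"
      by (intro unit \<eta> gauss_ints_mult gauss_ints_add g) auto
    ultimately show thesis using that[of "\<eta> * ((1 + \<i>) * g)" "1 / \<rho>"] \<eta>(2) by (simp add: mult_ac)
  qed
qed

section \<open>An upper bound for the solutions\<close>

text \<open>
  The mean value inequality for the fourth root on the vertical segment from \<open>s\<close>.
\<close>
lemma norm_quarter_powr_diff_le:
  assumes s: "s > 0" and b: "\<bar>b\<bar> \<le> 1"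
  shows "norm (Complex s b powr of_real (1/4) - of_real (s powr (1/4))) \<le> s powr (- 3/4) / 4"
proof -
  let ?S = "closed_segment (of_real s) (Complex s b)"
  let ?f = "\<lambda>w. w powr of_real (1/4)"
  have seg: "Re w = s" if "w \<in> ?S" for w
  proof -
    obtain u where "w = (1 - u) *\<^sub>R of_real s + u *\<^sub>R Complex s b"
      using \<open>w \<in> ?S\<close> by (auto simp: in_segment)
    then have "Re w = (1 - u) * s + u * s" by (simp only: plus_complex.sel scaleR_complex.sel Re_complex_of_real complex.sel)
    then show ?thesis by (simp add: algebra_simps)
  qed
  have "norm (?f (Complex s b) - ?f (of_real s)) \<le> s powr (- 3/4) / 4 * norm (Complex s b - of_real s)"
  proof (rule field_differentiable_bound)
    show "convex ?S" by simp
    fix w assume w: "w \<in> ?S"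
    have nz: "w \<notin> \<real>\<^sub>\<le>\<^sub>0" using seg[OF w] s by (auto simp: complex_nonpos_Reals_iff)
    show "(?f has_field_derivative of_real (1/4) * w powr (of_real (1/4) - 1)) (at w within ?S)"
      by (rule has_field_derivative_at_within[OF has_field_derivative_powr[OF nz]])
    have "of_real (1/4) - 1 = (of_real (- 3/4) :: complex)" by simp
    then have "norm (w powr (of_real (1/4) - 1)) = norm w powr (- 3/4)"
      by (simp only: norm_powr_real_powr'[OF Reals_of_real] Re_complex_of_real)
    also have "\<dots> \<le> s powr (- 3/4)"
      using s seg[OF w] complex_Re_le_cmod[of w] by (intro powr_mono2') auto
    finally show "norm (of_real (1/4) * w powr (of_real (1/4) - 1)) \<le> s powr (- 3/4) / 4"
      by (simp add: norm_mult)
  qed auto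
  also have "\<dots> \<le> s powr (- 3/4) / 4 * 1"
    using b by (intro mult_left_mono) (auto simp: cmod_def)
  also have "of_real s powr (of_real (1/4) :: complex) = of_real (s powr (1/4))"
    using s by (intro powr_of_real) simp
  finally show ?thesis by simp
qed

lemma quarter_powr_power4: "w \<noteq> 0 \<Longrightarrow> (w powr of_real (1/4)) ^ 4 = (w::complex)"
  by (simp add: powr_def flip: exp_of_nat_mult)

text \<open>
  Here \<open>239 powr (3/4)\<close> is at least \<open>60\<close>, since \<open>60 ^ 4 \<le> 239 ^ 3\<close>.
\<close>
lemma abs_Im_pade_239_le:
  "\<bar>Im (Complex 239 1 powr of_real (1/4) * pade (1/4) n (cnj (Complex 239 1)) (Complex 239 1))\<bar> \<le> 1 / (240 * 239 ^ n)"
proof -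
  have "\<bar>Im (Complex 239 1 powr of_real (1/4) * pade (1/4) n (cnj (Complex 239 1)) (Complex 239 1))\<bar>
      \<le> 1/4 * 239 powr (1/4 - real n - 1)"
    by (rule Im_pade_le) auto
  also have "239 powr (1/4 - real n - 1) = 239 powr (- (3/4)) * 239 powr (- real n)"
    unfolding powr_add[symmetric] by (rule arg_cong[where f = "\<lambda>e. 239 powr e"]) simp
  also have "\<dots> = 1 / (239 powr (3/4) * 239 ^ n)"
    by (simp add: powr_minus powr_realpow field_simps)
  also have "1/4 * \<dots> \<le> 1/4 * (1 / (60 * 239 ^ n))"
  proof -
    have "(60::real) = (60 ^ 4) powr (1/4)"
      by (subst powr_realpow[symmetric]) (simp_all only: powr_powr, simp_all)
    also have "\<dots> \<le> (239 ^ 3) powr (1/4)" by (intro powr_mono2) auto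
    also have "\<dots> = 239 powr (3/4)"
      by (subst powr_realpow[symmetric]) (simp_all only: powr_powr, simp_all)
    finally show ?thesis by (intro mult_left_mono divide_left_mono mult_right_mono mult_pos_pos) auto
  qed
  finally show ?thesis by simp
qed

lemma Im_complex_of_real_mult: "Im (of_real r * z) = r * Im z"
  by simp

lemma abs_Im_mult_le: "\<bar>Im (w * z)\<bar> \<le> norm w * \<bar>Im z\<bar> + \<bar>Im w\<bar> * norm z"
proof -
  have "\<bar>Im (w * z)\<bar> \<le> \<bar>Re w\<bar> * \<bar>Im z\<bar> + \<bar>Im w\<bar> * \<bar>Re z\<bar>"
    by (simp add: abs_mult[symmetric] abs_triangle_ineq)
  also have "\<dots> \<le> norm w * \<bar>Im z\<bar> + \<bar>Im w\<bar> * norm z"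
    by (intro add_mono mult_mono abs_Re_le_cmod) auto
  finally show ?thesis .
qed

text \<open>
  The first summand will bound the error of the approximant, scaled by \<open>t\<close>, which stands for the fourth root of
  \<open>x\<close>; the second bounds the contribution of the imaginary part of the fourth root of \<open>x + \<sigma> \<i>\<close>. If
  \<open>24 * 16 ^ N \<le> t < 24 * 16 ^ (N + 1)\<close> with \<open>N \<ge> 1\<close>, then the first summand decays like \<open>(64/239) ^ N\<close> and the
  second one like \<open>(3840/4096) ^ N\<close>, so both are small for \<open>n = N\<close> and for \<open>n = N + 1\<close>. The start \<open>384 = 24 * 16\<close>
  is what \<open>N \<ge> 1\<close> needs.
\<close>
lemma exists_pade_index:
  fixes t :: real
  assumes t: "t \<ge> 384"
  obtains N where "\<And>n. n \<in> {N, Suc N} \<Longrightarrow> 101/100 * t / 240 * (4/239) ^ n + 3840 ^ n / t ^ 3 < 21/25"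
proof -
  obtain k where "t < 16 ^ k" using real_arch_pow[of 16 t] by auto
  moreover have "(16::real) ^ k \<le> 24 * 16 ^ Suc k" by simp
  ultimately have "t < 24 * 16 ^ Suc k" by (rule less_le_trans)
  then have ex: "\<exists>n. t < 24 * 16 ^ Suc n" ..
  define N where "N = (LEAST n. t < 24 * 16 ^ Suc n)"
  have up: "t < 24 * 16 ^ Suc N" unfolding N_def by (rule LeastI_ex[OF ex])
  have "N \<noteq> 0" using up t by (intro notI) simp
  then obtain M where M: "N = Suc M" using not0_implies_Suc by blast
  have "\<not> t < 24 * 16 ^ Suc M" using not_less_Least[of M "\<lambda>n. t < 24 * 16 ^ Suc n"] M unfolding N_def by simp
  then have lo: "24 * 16 ^ N \<le> t" unfolding M by simp
  have t0: "t > 0" using t by simp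
  show thesis
  proof (rule that[of N])
    fix n assume n: "n \<in> {N, Suc N}"
    have "101/100 * t / 240 * (4/239) ^ n \<le> 101/100 * t / 240 * (4/239) ^ N"
      using n t0 by (intro mult_left_mono power_decreasing) auto
    also have "\<dots> \<le> 101/100 * (24 * 16 ^ Suc N) / 240 * (4/239) ^ N"
      using up by (intro mult_right_mono divide_right_mono mult_left_mono) auto
    also have "\<dots> = 1616/1000 * (64/239) ^ N"
      by (simp add: power_divide power_mult_distrib[symmetric])
    also have "\<dots> \<le> 1616/1000 * (64/239) ^ 1"
      using M by (intro mult_left_mono power_decreasing) auto
    finally have 1: "101/100 * t / 240 * (4/239) ^ n \<le> 1616/1000 * (64/239)" by simp
    have "3840 ^ n / t ^ 3 \<le> 3840 ^ Suc N / (24 * 16 ^ N) ^ 3"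
      using n lo by (intro frac_le power_increasing power_mono) auto
    also have "(24 * 16 ^ N) ^ 3 = (13824 * 4096 ^ N :: real)"
      by (simp add: power_mult_distrib power_mult[symmetric] mult.commute[of N] power_mult)
    also have "3840 ^ Suc N / (13824 * 4096 ^ N) = 3840 / 13824 * (3840/4096 :: real) ^ N"
      by (simp only: power_divide power_Suc times_divide_times_eq)
    also have "\<dots> \<le> 3840 / 13824 * (1::real)"
      by (intro mult_left_mono power_le_one) auto
    finally have 2: "3840 ^ n / t ^ 3 \<le> 3840 / 13824" by simp
    show "101/100 * t / 240 * (4/239) ^ n + 3840 ^ n / t ^ 3 < 21/25" using 1 2 by linarith
  qed
qed

text \<open>
  The comparison described at the beginning: for \<open>x \<ge> 384 ^ 4\<close> a quantity that is both a multiple of \<open>r\<close> by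
  an integer and smaller than \<open>r\<close> would vanish for two consecutive \<open>n\<close>.
\<close>
lemma ljunggren_solution_less:
  fixes x y :: int
  assumes x: "x > 0" and y: "y > 0" and eq: "1 + x\<^sup>2 = 2 * y ^ 4"
  shows "x < 384 ^ 4"
proof (rule ccontr)
  assume "\<not> x < 384 ^ 4"
  then have "real_of_int (384 ^ 4) \<le> real_of_int x" by (subst of_int_le_iff) simp
  then have x_ge: "384 ^ 4 \<le> real_of_int x" by simp
  define t where "t = real_of_int x powr (1/4)"
  have t_ge: "384 \<le> t"
  proof -
    have "(384::real) = (384 ^ 4) powr (1/4)"
      by (subst powr_realpow[symmetric]) (simp_all only: powr_powr, simp_all)
    also have "\<dots> \<le> t" unfolding t_def using x_ge by (intro powr_mono2) auto
    finally show ?thesis .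
  qed
  have t3: "real_of_int x powr (- 3/4) = 1 / t ^ 3"
  proof -
    have "t ^ 3 = real_of_int x powr (3/4)"
      using x by (simp add: t_def powr_realpow[symmetric] powr_powr del: powr_numeral) 
    then show ?thesis by (simp add: powr_minus field_simps)
  qed
  obtain \<beta> \<sigma> \<epsilon> where \<beta>: "\<beta> \<in> gauss_ints" and \<sigma>: "\<sigma> \<in> {1, -1::real}" and \<epsilon>: "\<epsilon> \<in> {1, -1::complex}"
    and z: "Complex (of_int x) \<sigma> = \<epsilon> * (1 + \<i>) * \<beta> ^ 4"
    by (rule ljunggren_fourth_power[OF assms])
  define v where "v = Complex 239 1"
  define \<gamma> where "\<gamma> = v powr of_real (1/4)"
  define \<delta> where "\<delta> = Complex (of_int x) \<sigma> powr of_real (1/4)"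
  define P where "P = (\<lambda>n. pade (1/4) n (cnj v) v)"
  \<comment> \<open>The factor \<open>3 - 2 * \<i>\<close> is the one that belongs to the solution \<open>(239, 13)\<close>.\<close>
  define g where "g = Complex 3 (-2) * \<beta>"
  have "v \<noteq> 0" "Complex (of_int x) \<sigma> \<noteq> 0" using x by (auto simp: v_def complex_eq_iff)
  then have \<gamma>4: "\<gamma> ^ 4 = v" and \<delta>4: "\<delta> ^ 4 = Complex (of_int x) \<sigma>"
    unfolding \<gamma>_def \<delta>_def by (blast intro: quarter_powr_power4)+
  have nz: "\<gamma> * \<delta> \<noteq> 0"
    using \<gamma>4 \<delta>4 \<open>v \<noteq> 0\<close> \<open>Complex (of_int x) \<sigma> \<noteq> 0\<close> by auto
  have v_eq: "v = - (1 - \<i>) * Complex 3 (-2) ^ 4"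
    by (simp add: v_def complex_eq_iff power4_eq_xxxx)
  have "(\<gamma> * \<delta>) ^ 4 = (- (1 - \<i>) * Complex 3 (-2) ^ 4) * (\<epsilon> * (1 + \<i>) * \<beta> ^ 4)"
    unfolding power_mult_distrib \<gamma>4 \<delta>4 z v_eq ..
  also have "\<dots> = - \<epsilon> * ((1 - \<i>) * (1 + \<i>)) * g ^ 4"
    unfolding g_def power_mult_distrib by (simp only: mult_ac mult_minus_left mult_minus_right)
  also have "(1 - \<i>) * (1 + \<i>) = 2" by (simp add: complex_eq_iff)
  finally have w4: "(\<gamma> * \<delta>) ^ 4 = - \<epsilon> * 2 * g ^ 4" .
  have "Complex 3 (-2) \<in> gauss_ints" by (simp add: gauss_ints_def)
  then have "g \<in> gauss_ints" unfolding g_def using \<beta> by (rule gauss_ints_mult)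
  moreover have "- \<epsilon> \<in> {1, -1}" using \<epsilon> by auto
  ultimately obtain r h where h: "h \<in> gauss_ints" and r: "r \<ge> 21/25" and w: "\<gamma> * \<delta> = of_real r * h"
    using w4 by (rule fourth_root_real_times_gauss_int)
  have h0: "h \<noteq> 0" using nz w by auto
  have vu: "v - cnj v = 2 * \<i>" by (simp add: v_def complex_eq_iff)
  have \<delta>_near: "norm (\<delta> - of_real t) \<le> 1 / t ^ 3 / 4"
    unfolding \<delta>_def t_def t3[unfolded t_def, symmetric]
    using \<sigma> x by (intro norm_quarter_powr_diff_le) auto
  have Im\<delta>: "\<bar>Im \<delta>\<bar> \<le> 1 / (4 * t ^ 3)"
    using order_trans[OF abs_Im_le_cmod \<delta>_near] by simp
  have "norm \<delta> \<le> norm (\<delta> - of_real t) + norm (of_real t :: complex)"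
    using norm_triangle_ineq[of "\<delta> - of_real t" "of_real t"] by simp
  also have "\<dots> \<le> 1 / t ^ 3 / 4 + t" using \<delta>_near t_ge by simp
  also have "1 / t ^ 3 / 4 \<le> 1 / 1 / 4" using t_ge by (intro divide_right_mono divide_left_mono one_le_power) auto
  finally have norm\<delta>: "norm \<delta> \<le> 101/100 * t" using t_ge by simp
  have norm_v: "norm v \<le> 240" unfolding v_def cmod_def by (rule real_le_lsqrt) auto
  have "norm \<gamma> ^ 4 = norm v" unfolding norm_power[symmetric] \<gamma>4 ..
  then have "norm \<gamma> ^ 4 \<le> 4 ^ 4" using norm_v by simp
  then have norm\<gamma>: "norm \<gamma> \<le> 4" by (subst (asm) power_mono_iff) auto
  \<comment> \<open>Both \<open>\<gamma> * P n\<close> and \<open>\<delta>\<close> are nearly real, hence so is their product.\<close>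
  have small: "\<bar>Im (4 ^ n * P n * (\<gamma> * \<delta>))\<bar> \<le> 101/100 * t / 240 * (4/239) ^ n + 3840 ^ n / t ^ 3" for n
  proof -
    have "\<bar>Im (\<gamma> * P n * \<delta>)\<bar> \<le> norm (\<gamma> * P n) * \<bar>Im \<delta>\<bar> + \<bar>Im (\<gamma> * P n)\<bar> * norm \<delta>"
      by (rule abs_Im_mult_le)
    also have "\<dots> \<le> (4 * (4 * 240) ^ n) * (1 / (4 * t ^ 3)) + 1 / (240 * 239 ^ n) * (101/100 * t)"
    proof (intro add_mono mult_mono)
      show "norm (\<gamma> * P n) \<le> 4 * (4 * 240) ^ n"
        unfolding norm_mult P_def using norm\<gamma> norm_v by (intro mult_mono norm_pade_le) auto
      show "\<bar>Im (\<gamma> * P n)\<bar> \<le> 1 / (240 * 239 ^ n)"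
        unfolding \<gamma>_def P_def v_def by (rule abs_Im_pade_239_le)
    qed (use Im\<delta> norm\<delta> t_ge in auto)
    finally have "4 ^ n * \<bar>Im (\<gamma> * P n * \<delta>)\<bar> \<le>
        4 ^ n * ((4 * (4 * 240) ^ n) * (1 / (4 * t ^ 3)) + 1 / (240 * 239 ^ n) * (101/100 * t))"
      by (rule mult_left_mono) simp
    also have "\<dots> = 101/100 * t / 240 * (4/239) ^ n + (4 * (4 * 240)) ^ n / t ^ 3"
      by (simp only: power_mult_distrib power_divide) (simp add: field_simps)
    also have "4 ^ n * \<bar>Im (\<gamma> * P n * \<delta>)\<bar> = \<bar>Im (4 ^ n * P n * (\<gamma> * \<delta>))\<bar>"
    proof -
      have "4 ^ n * P n * (\<gamma> * \<delta>) = of_real (4 ^ n) * (\<gamma> * P n * \<delta>)" by simp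
      then show ?thesis by (simp only: Im_complex_of_real_mult abs_mult) simp
    qed
    finally show ?thesis by simp
  qed
  \<comment> \<open>A nonzero imaginary part of a Gaussian integer is at least \<open>1\<close> in absolute value.\<close>
  have vanish: "Im (P n * h) = 0" if bound: "101/100 * t / 240 * (4/239) ^ n + 3840 ^ n / t ^ 3 < 21/25" for n
  proof (rule ccontr)
    assume ne: "Im (P n * h) \<noteq> 0"
    have cv: "cnj v \<in> gauss_ints" by (simp add: v_def gauss_ints_def)
    have "4 ^ n * P n * h \<in> gauss_ints" unfolding P_def
      by (rule gauss_ints_mult[OF pow4_times_pade_gauss_ints[OF cv vu] h])
    then have "Im (4 ^ n * P n * h) \<in> \<int>" by (simp add: gauss_ints_def)
    moreover have eq: "Im (4 ^ n * P n * h) = 4 ^ n * Im (P n * h)"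
    proof -
      have "4 ^ n * P n * h = of_real (4 ^ n) * (P n * h)" by simp
      then show ?thesis by (simp only: Im_complex_of_real_mult)
    qed
    ultimately have 1: "1 \<le> \<bar>Im (4 ^ n * P n * h)\<bar>" using ne by (intro Ints_nonzero_abs_ge1) auto
    have "4 ^ n * P n * (\<gamma> * \<delta>) = of_real r * (4 ^ n * P n * h)" unfolding w by (simp only: mult_ac)
    then have "\<bar>Im (4 ^ n * P n * (\<gamma> * \<delta>))\<bar> = r * \<bar>Im (4 ^ n * P n * h)\<bar>"
      using r by (simp only: Im_complex_of_real_mult abs_mult)
    moreover have "r * 1 \<le> r * \<bar>Im (4 ^ n * P n * h)\<bar>" using 1 r by (intro mult_left_mono) auto
    ultimately have "21/25 \<le> \<bar>Im (4 ^ n * P n * (\<gamma> * \<delta>))\<bar>" using r by linarith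
    then show False using small[of n] bound by linarith
  qed
  obtain N where N: "\<And>n. n \<in> {N, Suc N} \<Longrightarrow> 101/100 * t / 240 * (4/239) ^ n + 3840 ^ n / t ^ 3 < 21/25"
    using exists_pade_index[OF t_ge] by blast
  \<comment> \<open>Multiplying one real number by the conjugate of the other eliminates the unknown \<open>h\<close>.\<close>
  have "Im (P N * h) = 0" "Im (P (Suc N) * h) = 0" by (intro vanish N; simp)+
  then have "Im ((P N * h) * cnj (P (Suc N) * h)) = 0" by simp
  moreover have "(P N * h) * cnj (P (Suc N) * h) = of_real ((norm h)\<^sup>2) * (P N * cnj (P (Suc N)))"
    unfolding complex_cnj_mult complex_norm_square by (simp only: mult_ac)
  ultimately have "(norm h)\<^sup>2 * Im (P N * cnj (P (Suc N))) = 0" by (simp only: Im_complex_of_real_mult)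
  then have "Im (P N * cnj (P (Suc N))) = 0" using h0 by simp
  moreover have "(1/4::real) \<notin> \<int>"
  proof
    assume "(1/4::real) \<in> \<int>"
    then obtain k where "(1/4::real) = of_int k" by (auto elim: Ints_cases)
    then have "real_of_int (4 * k) = real_of_int 1" by simp
    then have "4 * k = 1" by (simp only: of_int_eq_iff)
    then show False by presburger
  qed
  ultimately show False using Im_pade_consecutive_neq_0[of "1/4" v N] by (simp add: P_def v_def)
qed

section \<open>The solutions below the bound\<close>

text \<open>
  Multiplying \<open>x + z * sqrt 2\<close> by \<open>3 - 2 * sqrt 2\<close>, a unit of norm \<open>1\<close>, produces a smaller solution.
\<close>
lemma negative_pell_descent:
  fixes x z :: int
  assumes "x > 0" "z > 1" "1 + x\<^sup>2 = 2 * z\<^sup>2"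
  shows "3 * x - 4 * z > 0" "3 * z - 2 * x > 0" "1 + (3 * x - 4 * z)\<^sup>2 = 2 * (3 * z - 2 * x)\<^sup>2" "3 * z - 2 * x < z"
proof -
  have z2: "z \<noteq> 2"
  proof
    assume "z = 2"
    then have 7: "x * x = 7" using assms(3) by (simp add: power2_eq_square)
    show False
    proof (cases "x \<le> 2")
      case True
      then have "x = 1 \<or> x = 2" using assms(1) by auto
      then show False using 7 by auto
    next
      case False
      then have "3 * 3 \<le> x * x" by (intro mult_mono) auto
      then show False using 7 by simp
    qed
  qed
  then have "3 * 3 \<le> z * z" using assms(2) by (intro mult_mono) auto
  then have z9: "9 \<le> z\<^sup>2" by (simp add: power2_eq_square)
  have "(4 * z)\<^sup>2 < (3 * x)\<^sup>2" using assms(3) z9 by (simp add: power_mult_distrib)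
  then show a: "3 * x - 4 * z > 0" using assms power2_less_imp_less[of "4 * z" "3 * x"] by simp
  have "(2 * x)\<^sup>2 < (3 * z)\<^sup>2" using assms(3) z9 by (simp add: power_mult_distrib)
  then show "3 * z - 2 * x > 0" using assms power2_less_imp_less[of "2 * x" "3 * z"] by simp
  show "1 + (3 * x - 4 * z)\<^sup>2 = 2 * (3 * z - 2 * x)\<^sup>2"
    using assms(3) by (simp add: power2_eq_square algebra_simps)
  have "x > z"
  proof (rule ccontr)
    assume "\<not> x > z"
    then have "x\<^sup>2 \<le> z\<^sup>2" using assms by (intro power_mono) auto
    then show False using assms(3) z9 by linarith
  qed
  then show "3 * z - 2 * x < z" by simp
qed

fun pell_seq :: "nat \<Rightarrow> int \<times> int" where
  "pell_seq 0 = (1, 1)"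
| "pell_seq (Suc n) = (case pell_seq n of (x, z) \<Rightarrow> (3 * x + 4 * z, 2 * x + 3 * z))"

lemma negative_pell_solution:
  fixes x z :: int
  assumes "x > 0" "z > 0" "1 + x\<^sup>2 = 2 * z\<^sup>2"
  shows "\<exists>n. (x, z) = pell_seq n"
  using assms
proof (induction "nat z" arbitrary: x z rule: less_induct)
  case less
  show ?case
  proof (cases "z = 1")
    case True
    then have "x = 1" using less.prems by (simp add: power2_eq_1_iff)
    then show ?thesis using True by (intro exI[of _ 0]) simp
  next
    case False
    then have z: "z > 1" using less.prems by simp
    note d = negative_pell_descent[OF less.prems(1) z less.prems(3)]
    have "\<exists>n. (3 * x - 4 * z, 3 * z - 2 * x) = pell_seq n"
      by (rule less.hyps) (use d z in auto)
    then obtain n where "(3 * x - 4 * z, 3 * z - 2 * x) = pell_seq n" ..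
    then show ?thesis by (intro exI[of _ "Suc n"]) (simp flip: \<open>_ = pell_seq n\<close>)
  qed
qed

lemma pell_seq_pos: "fst (pell_seq n) > 0 \<and> snd (pell_seq n) > 0"
  by (induction n) (auto split: prod.splits)

lemma fst_pell_seq_mono: "m \<le> n \<Longrightarrow> fst (pell_seq m) \<le> fst (pell_seq n)"
proof (rule lift_Suc_mono_le)
  fix n
  show "fst (pell_seq n) \<le> fst (pell_seq (Suc n))"
    using pell_seq_pos[of n] by (auto split: prod.splits)
qed

lemma square_neq_between_squares:
  fixes a y z :: int
  assumes "a \<ge> 0" "y > 0" "a * a < z" "z < (a + 1) * (a + 1)"
  shows "y\<^sup>2 \<noteq> z"
proof (cases "y \<le> a")
  case True
  then have "y * y \<le> a * a" using assms by (intro mult_mono) auto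
  then show ?thesis using assms by (simp add: power2_eq_square)
next
  case False
  then have "(a + 1) * (a + 1) \<le> y * y" using assms by (intro mult_mono) auto
  then show ?thesis using assms by (simp add: power2_eq_square)
qed

text \<open>
  The other values of \<open>z\<close> are strictly between two consecutive squares.
\<close>
lemma pell_seq_square:
  fixes y :: int
  assumes "n < 14" and y: "y > 0" and "snd (pell_seq n) = y\<^sup>2"
  shows "n = 0 \<or> n = 3"
proof -
  have "n = 0 \<or> n = 1 \<or> n = 2 \<or> n = 3 \<or> n = 4 \<or> n = 5 \<or> n = 6 \<or> n = 7 \<or> n = 8 \<or> n = 9 \<or> n = 10 \<or> n = 11 \<or> n = 12 \<or> n = 13"
    using assms(1) by presburger
  then show ?thesis
    using assms(3)
      square_neq_between_squares[OF _ y, of 2 5] square_neq_between_squares[OF _ y, of 5 29]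
      square_neq_between_squares[OF _ y, of 31 985] square_neq_between_squares[OF _ y, of 75 5741]
      square_neq_between_squares[OF _ y, of 182 33461] square_neq_between_squares[OF _ y, of 441 195025]
      square_neq_between_squares[OF _ y, of 1066 1136689] square_neq_between_squares[OF _ y, of 2573 6625109]
      square_neq_between_squares[OF _ y, of 6214 38613965] square_neq_between_squares[OF _ y, of 15001 225058681]
      square_neq_between_squares[OF _ y, of 36217 1311738121] square_neq_between_squares[OF _ y, of 87437 7645370045]
    by (elim disjE) (simp_all add: eval_nat_numeral)
qed

theorem theorem1:
  fixes x y :: int
  assumes "x > 0" and "y > 0"
  shows "1 + x ^ 2 = 2 * y ^ 4 \<longleftrightarrow> (x, y) = (1, 1) \<or> (x, y) = (239, 13)"
proof
  assume eq: "1 + x ^ 2 = 2 * y ^ 4"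
  have "1 + x\<^sup>2 = 2 * (y\<^sup>2)\<^sup>2" using eq by simp
  then obtain n where n: "(x, y\<^sup>2) = pell_seq n"
    using negative_pell_solution[of x "y\<^sup>2"] assms by auto
  have "n < 14"
  proof (rule ccontr)
    assume "\<not> n < 14"
    then have "fst (pell_seq 14) \<le> x" using fst_pell_seq_mono[of 14 n] by (simp flip: n)
    moreover have "fst (pell_seq 14) = 63018038201" by (simp add: eval_nat_numeral)
    ultimately show False using ljunggren_solution_less[OF assms eq] by simp
  qed
  then have "n = 0 \<or> n = 3" using pell_seq_square[of n y] assms(2) by (simp flip: n)
  then have "x = 1 \<and> y\<^sup>2 = 1\<^sup>2 \<or> x = 239 \<and> y\<^sup>2 = 13\<^sup>2"
    using n by (auto simp: eval_nat_numeral)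
  then have "x = 1 \<and> y = 1 \<or> x = 239 \<and> y = 13"
    using assms(2) power2_eq_iff_nonneg[of y 1] power2_eq_iff_nonneg[of y 13] by auto
  then show "(x, y) = (1, 1) \<or> (x, y) = (239, 13)" by simp
next
  assume "(x, y) = (1, 1) \<or> (x, y) = (239, 13)"
  then show "1 + x ^ 2 = 2 * y ^ 4" by auto
qed

end
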